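(* There exists a random vector field $v=(v^1,v^2)$ on $\mathbb{R}^2$, defined on some probability space, which is smooth ($C^\infty$), stationary and strongly mixing (with respect to the $\mathbb{R}^2$-action by spatial shifts), such that with probability $1$, for all $z\in\mathbb{R}^2$, $$v^1(z)\ge 0,\quad v^2(z)\ge 0,\quad v^1(z)+v^2(z)=1,$$ and the integral curve $\gamma_z=(\gamma_z^1,\gamma_z^2):[0,\infty)\to\mathbb{R}^2$ of $v$ started at $z$ satisfies $$\lim_{t\to\infty}|\gamma_z(t)|=\infty,$$ $$\liminf_{t\to\infty}\frac{\gamma_z^2(t)}{\gamma_z^1(t)}=0,\qquad \limsup_{t\to\infty}\frac{\gamma_z^2(t)}{\gamma_z^1(t)}=\infty.$$
   Context: For a smooth vector field $v$ on $\mathbb{R}^2$ and $z\in\mathbb{R}^2$, the integral curve $\gamma_z:[0,\infty)\to\mathbb{R}^2$ is the unique solution of the autonomous ODE $\dot\gamma_z(t)=v(\gamma_z(t))$ with $\gamma_z(0)=z$. Superscripts $1,2$ denote components (coordinates), not powers. Let $\mathcal{M}$ be the space of continuous vector fields on $\mathbb{R}^2$ with the metric of locally uniform convergence $d(u,w)=\sum_{n=1}^{\infty}2^{-n}\min\big(\|u-w\|_{C([-n,n]^2)},1\big)$ and Borel $\sigma$-algebra $\mathcal{B}(\mathcal{M})$. For $z\in\mathbb{R}^2$ let $\theta^z:\mathcal{M}\to\mathcal{M}$ be the shift $(\theta^z u)(x)=u(x+z)$. A random vector field $v$ with law $\mathsf{P}_{\mathcal{M}}$ on $(\mathcal{M},\mathcal{B}(\mathcal{M}))$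 is stationary if $\mathsf{P}_{\mathcal{M}}$ is invariant under $\theta^z$ for every $z\in\mathbb{R}^2$; a stationary $v$ is strongly mixing if for all $A,B\in\mathcal{B}(\mathcal{M})$, $$\lim_{|z|_1\to\infty}\big|\mathsf{P}_{\mathcal{M}}(A\cap\theta^zB)-\mathsf{P}_{\mathcal{M}}(A)\mathsf{P}_{\mathcal{M}}(B)\big|=0,$$ where $|z|_1=|z^1|+|z^2|$ and $\theta^zB=\{\theta^z u:u\in B\}$. *)

theory Defs
  imports "HOL-Probability.Probability"
begin

type_synonym vector_field = "real^2 \<Rightarrow> real^2"

text \<open>
  On the whole space, \<open>C\<^sup>k\<close> in the usual sense: \<open>C\<^sup>0\<close> is continuity, and
  \<open>C\<^sup>k\<^sup>+\<^sup>1\<close> means differentiability with all directional derivatives \<open>C\<^sup>k\<close>.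
\<close>

primrec C_k :: "nat \<Rightarrow> ('a::euclidean_space \<Rightarrow> 'b::real_normed_vector) \<Rightarrow> bool" where
  "C_k 0 f \<longleftrightarrow> continuous_on UNIV f"
| "C_k (Suc k) f \<longleftrightarrow>
     (\<forall>x. f differentiable (at x)) \<and> (\<forall>h. C_k k (\<lambda>x. frechet_derivative f (at x) h))"

definition smooth :: "('a::euclidean_space \<Rightarrow> 'b::real_normed_vector) \<Rightarrow> bool" where
  "smooth f \<longleftrightarrow> (\<forall>k. C_k k f)"

text \<open>
  Curves are total functions on the reals; only their values on \<open>[0,\<infinity>)\<close> matter
  (at \<open>t = 0\<close> the derivative is one-sided).
\<close>

definition solves_from :: "vector_field \<Rightarrow> real^2 \<Rightarrow> (real \<Rightarrow> real^2) \<Rightarrow> bool" where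
  "solves_from v z \<gamma> \<longleftrightarrow>
     \<gamma> 0 = z \<and> (\<forall>t\<ge>0. (\<gamma> has_vector_derivative v (\<gamma> t)) (at t within {0..}))"

definition integral_curve :: "vector_field \<Rightarrow> real^2 \<Rightarrow> (real \<Rightarrow> real^2) \<Rightarrow> bool" where
  "integral_curve v z \<gamma> \<longleftrightarrow>
     solves_from v z \<gamma> \<and> (\<forall>\<delta>. solves_from v z \<delta> \<longrightarrow> (\<forall>t\<ge>0. \<delta> t = \<gamma> t))"

definition cont_fields :: "vector_field set" where
  "cont_fields = {u. continuous_on UNIV u}"

definition square :: "nat \<Rightarrow> (real^2) set" where
  "square n = {x. \<bar>x$1\<bar> \<le> real n \<and> \<bar>x$2\<bar> \<le> real n}"

definition sup_dist :: "nat \<Rightarrow> vector_field \<Rightarrow> vector_field \<Rightarrow> real" where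
  "sup_dist n u w = (SUP x\<in>square n. norm (u x - w x))"

text \<open>
  The series starts at \<open>n = 1\<close>, hence the index shift. The value outside
  \<^const>\<open>cont_fields\<close> is irrelevant; it is \<open>0\<close> because \<^locale>\<open>Metric_space\<close>
  requires a nonnegative distance on the whole type.
\<close>

definition field_dist :: "vector_field \<Rightarrow> vector_field \<Rightarrow> real" where
  "field_dist u w =
     (if u \<in> cont_fields \<and> w \<in> cont_fields
      then \<Sum>n. (1/2) ^ Suc n * min (sup_dist (Suc n) u w) 1 else 0)"

lemma zero_in_square: "0 \<in> square n"
  by (simp add: square_def)

lemma compact_square: "compact (square n)"
proof -
  have "square n = cbox (\<chi> i. - real n) (\<chi> i. real n)"
    by (auto simp: square_def mem_box_cart forall_2)
  then show ?thesis by simp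
qed

lemma bdd_sup_dist:
  assumes "u \<in> cont_fields" "w \<in> cont_fields"
  shows "bdd_above ((\<lambda>x. norm (u x - w x)) ` square n)"
proof -
  have "continuous_on (square n) (\<lambda>x. norm (u x - w x))"
    using assms unfolding cont_fields_def
    by (auto intro!: continuous_intros intro: continuous_on_subset)
  then show ?thesis
    by (intro bounded_imp_bdd_above compact_imp_bounded compact_continuous_image compact_square)
qed

lemma le_sup_dist:
  assumes "u \<in> cont_fields" "w \<in> cont_fields" "x \<in> square n"
  shows "norm (u x - w x) \<le> sup_dist n u w"
  unfolding sup_dist_def by (rule cSUP_upper[OF assms(3) bdd_sup_dist[OF assms(1,2)]])

lemma sup_dist_nonneg:
  assumes "u \<in> cont_fields" "w \<in> cont_fields"
  shows "0 \<le> sup_dist n u w"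
  using le_sup_dist[OF assms zero_in_square] norm_ge_zero order_trans by blast

lemma sup_dist_triangle:
  assumes "u \<in> cont_fields" "v \<in> cont_fields" "w \<in> cont_fields"
  shows "sup_dist n u w \<le> sup_dist n u v + sup_dist n v w"
  unfolding sup_dist_def[of n u w]
proof (rule cSUP_least)
  show "square n \<noteq> {}" using zero_in_square by blast
  fix x assume x: "x \<in> square n"
  have "norm (u x - w x) \<le> norm (u x - v x) + norm (v x - w x)"
    by (metis dist_norm dist_triangle)
  then show "norm (u x - w x) \<le> sup_dist n u v + sup_dist n v w"
    using le_sup_dist[OF assms(1,2) x] le_sup_dist[OF assms(2,3) x] by linarith
qed

lemma field_dist_summable:
  assumes "u \<in> cont_fields" "w \<in> cont_fields"
  shows "summable (\<lambda>n. (1/2) ^ Suc n * min (sup_dist (Suc n) u w) 1)"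
proof (rule summable_comparison_test[where g = "\<lambda>n. (1/2) ^ Suc n"])
  show "\<exists>N. \<forall>n\<ge>N. norm ((1/2) ^ Suc n * min (sup_dist (Suc n) u w) 1) \<le> (1/2) ^ Suc n"
    using sup_dist_nonneg[OF assms] by (auto simp: abs_mult)
  show "summable (\<lambda>n. (1/2::real) ^ Suc n)"
    by (subst summable_Suc_iff) (rule summable_geometric, simp)
qed

lemma Metric_space_cont_fields: "Metric_space cont_fields field_dist"
proof
  have comm: "field_dist u w = field_dist w u" for u w
    by (auto simp: field_dist_def sup_dist_def norm_minus_commute)
  have zero: "u = w" if uw: "u \<in> cont_fields" "w \<in> cont_fields" and 0: "field_dist u w = 0" for u w
  proof
    fix x :: "real^2"
    obtain n where n: "norm x \<le> real n" using real_arch_simple by blast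
    have x: "x \<in> square (Suc n)"
      using n component_le_norm_cart[of x 1] component_le_norm_cart[of x 2]
      by (auto simp: square_def)
    have "(1/2) ^ Suc n * min (sup_dist (Suc n) u w) 1 = 0"
      using 0 uw sup_dist_nonneg[OF uw] suminf_eq_zero_iff[OF field_dist_summable[OF uw]]
      unfolding field_dist_def by simp
    then have "sup_dist (Suc n) u w = 0" by (auto simp: min_def split: if_splits)
    then show "u x = w x" using le_sup_dist[OF uw x] by simp
  qed
  show "0 \<le> field_dist u w" for u w
  proof (cases "u \<in> cont_fields \<and> w \<in> cont_fields")
    case True
    then show ?thesis
      using suminf_nonneg[OF field_dist_summable] sup_dist_nonneg by (simp add: field_dist_def)
  qed (auto simp: field_dist_def)
  show "field_dist u w = field_dist w u" for u w by (rule comm)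
  show "(field_dist u w = 0) = (u = w)" if "u \<in> cont_fields" "w \<in> cont_fields" for u w
  proof
    have "square n \<noteq> {}" for n using zero_in_square by blast
    then show "field_dist u w = 0" if "u = w"
      using that by (simp add: field_dist_def sup_dist_def)
  qed (rule zero[OF that])
  show "field_dist u w \<le> field_dist u v + field_dist v w"
    if "u \<in> cont_fields" "v \<in> cont_fields" "w \<in> cont_fields" for u v w
  proof -
    have "(1/2) ^ Suc n * min (sup_dist (Suc n) u w) 1
        \<le> (1/2) ^ Suc n * min (sup_dist (Suc n) u v) 1 + (1/2) ^ Suc n * min (sup_dist (Suc n) v w) 1" for n
    proof -
      have "min (sup_dist (Suc n) u w) 1 \<le> min (sup_dist (Suc n) u v) 1 + min (sup_dist (Suc n) v w) 1"
        using sup_dist_triangle[OF that, of "Suc n"] sup_dist_nonneg[OF that(1,2), of "Suc n"]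
          sup_dist_nonneg[OF that(2,3), of "Suc n"] by linarith
      then show ?thesis by (simp flip: distrib_left)
    qed
    then have "(\<Sum>n. (1/2) ^ Suc n * min (sup_dist (Suc n) u w) 1)
        \<le> (\<Sum>n. (1/2) ^ Suc n * min (sup_dist (Suc n) u v) 1 + (1/2) ^ Suc n * min (sup_dist (Suc n) v w) 1)"
      by (intro suminf_le summable_add field_dist_summable that)
    then show ?thesis
      using that suminf_add[OF field_dist_summable[OF that(1,2)] field_dist_summable[OF that(2,3)]]
      by (simp add: field_dist_def)
  qed
qed

definition borel_fields :: "vector_field measure" where
  "borel_fields =
     sigma cont_fields {U. openin (Metric_space.mtopology cont_fields field_dist) U}"

definition shift :: "real^2 \<Rightarrow> vector_field \<Rightarrow> vector_field" where
  "shift z u = (\<lambda>x. u (x + z))"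

text \<open>In the next two definitions \<open>P\<close> is the law of the random field, a measure on \<^const>\<open>borel_fields\<close>.\<close>

definition stationary :: "vector_field measure \<Rightarrow> bool" where
  "stationary P \<longleftrightarrow> (\<forall>z. distr P borel_fields (shift z) = P)"

definition strongly_mixing :: "vector_field measure \<Rightarrow> bool" where
  "strongly_mixing P \<longleftrightarrow>
     (\<forall>A\<in>sets borel_fields. \<forall>B\<in>sets borel_fields.
        ((\<lambda>z. \<bar>measure P (A \<inter> shift z ` B) - measure P A * measure P B\<bar>) \<longlongrightarrow> 0)
          (filtercomap (\<lambda>z. \<bar>z$1\<bar> + \<bar>z$2\<bar>) at_top))"

end

theory Submission
  imports Defs
begin

text \<open>
  A curve that solves \<open>\<gamma>' = v(\<gamma>)\<close> with \<open>v\<^sup>1, v\<^sup>2 \<ge> 0\<close> and \<open>v\<^sup>1 + v\<^sup>2 = 1\<close> moves up and to the right.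
  A horizontal segment on which \<open>v = (1, 0)\<close> is a ceiling for it: a curve that starts below cannot
  cross the segment, so it has to run to the right until the segment ends. If the segment is much
  longer than its distance from the starting point, the curve leaves it with a very small
  \<open>\<gamma>\<^sup>2/\<gamma>\<^sup>1\<close>. Vertical segments with \<open>v = (0, 1)\<close> make the ratio large in the same way. It therefore
  suffices to scatter such barriers at random so that almost surely every curve meets ever longer
  ones of both kinds.

  Let \<open>R = 4^(n\<^sup>2)\<close> be the length attached to the scale \<open>n\<close>. The barriers of this scale are horizontal
  for odd \<open>n\<close> and vertical for even \<open>n\<close>; they have width \<open>2\<close>, length about \<open>4 n R\<close>, and centres that
  form a Poisson process of intensity \<open>R\<^sup>-\<^sup>2\<close>. Where barriers cross, the larger scale overrules the
  smaller one. Two things can go wrong with the scale \<open>n\<close> near the origin. There may be no centre of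
  scale \<open>n\<close> in a given \<open>2nR \<times> R/2\<close> rectangle at distance \<open>R/2\<close>: this has probability \<open>exp(-n)\<close>. Or a
  barrier of a scale \<open>m > n\<close> may touch the square of side about \<open>2nR\<close> around the origin: by a first
  moment bound, the probability is at most of order \<open>m n R\<^sub>n / R\<^sub>m\<close>, and because \<open>R\<close> grows faster
  than exponentially, the sum over \<open>m > n\<close> is at most of order \<open>2^(-n)\<close>. By the
  Borel-Cantelli lemma (\<open>AE_good_scales\<close>) only finitely many scales fail. A good scale traps the
  curves from all starting points that are close to the origin on that scale, so one null set
  serves for every starting point, and the alternation of the two kinds gives lower limit \<open>0\<close> and
  upper limit \<open>\<infinity>\<close> (\<open>integral_curve_oscillates\<close>).

  All scales come from one Poisson process of unit intensity on \<open>\<real>\<^sup>2 \<times> \<real>\<close>, whose last coordinate, the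
  mark, selects the scale: the marks of scale \<open>n\<close> fill an interval of length \<open>R\<^sup>-\<^sup>2\<close>. The
  \<open>\<sigma>\<close>-algebra on configurations is generated by the events that a bounded Borel set contains no
  point. These events form a \<open>\<pi>\<close>-system and have probability \<open>exp(- vol A)\<close>. Hence invariance
  under translations is inherited from Lebesgue measure, and two such events for disjoint sets are
  exactly independent, which gives mixing on the \<open>\<pi>\<close>-system and then, by Dynkin's argument, on the
  whole \<open>\<sigma>\<close>-algebra. Both properties pass to the field, which is an equivariant measurable function
  of the configuration.

  Smoothness comes from convolving the piecewise constant direction field with a bump of radius
  \<open>1/2\<close>. Barriers have half-width \<open>1\<close>, so the directions survive around their centre lines. The
  result is smooth for every configuration, with a Lipschitz constant that does not depend on the
  configuration; this yields global integral curves and reduces measurability of the field to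
  measurability of its point evaluations.
\<close>

section \<open>A smooth bump function\<close>

lemma C_k_SucI:
  assumes "\<And>x. (f has_derivative f' x) (at x)" "\<And>h. C_k k (\<lambda>x. f' x h)"
  shows "C_k (Suc k) f"
proof -
  have "frechet_derivative f (at x) = f' x" for x
    using frechet_derivative_at[OF assms(1)] by simp
  then show ?thesis using assms by (auto simp: differentiable_def)
qed

lemma C_k_SucD:
  assumes "C_k (Suc k) f"
  shows "(f has_derivative frechet_derivative f (at x)) (at x)" "C_k k (\<lambda>x. frechet_derivative f (at x) h)"
  using assms by (auto simp: frechet_derivative_works)

lemma C_k_mono: "C_k (Suc k) f \<Longrightarrow> C_k k f"
proof (induction k arbitrary: f)
  case 0
  then show ?case
    by (auto intro!: differentiable_imp_continuous_on simp: differentiable_on_def)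
next
  case (Suc k)
  show ?case
    by (rule C_k_SucI[OF C_k_SucD(1)[OF Suc.prems]]) (rule Suc.IH, rule C_k_SucD(2)[OF Suc.prems])
qed

lemma C_k_const: "C_k k (\<lambda>x. c)"
proof (induction k arbitrary: c)
  case (Suc k)
  show ?case by (rule C_k_SucI[where f' = "\<lambda>_ _. 0"]) (use Suc in auto)
qed auto

lemma C_k_inner_left: "C_k k (\<lambda>x. x \<bullet> a)"
proof (cases k)
  case (Suc n)
  show ?thesis unfolding Suc
    by (rule C_k_SucI[where f' = "\<lambda>x h. h \<bullet> a"]) (auto intro!: derivative_eq_intros C_k_const)
qed (auto intro!: continuous_intros)

lemma C_k_add: "C_k k f \<Longrightarrow> C_k k g \<Longrightarrow> C_k k (\<lambda>x. f x + g x)"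
proof (induction k arbitrary: f g)
  case (Suc k)
  note f = C_k_SucD[OF Suc.prems(1)] and g = C_k_SucD[OF Suc.prems(2)]
  show ?case
    by (rule C_k_SucI[OF has_derivative_add[OF f(1) g(1)]]) (intro Suc.IH f(2) g(2))
qed (auto intro!: continuous_intros)

lemma C_k_mult:
  fixes f g :: "'a::euclidean_space \<Rightarrow> real"
  shows "C_k k f \<Longrightarrow> C_k k g \<Longrightarrow> C_k k (\<lambda>x. f x * g x)"
proof (induction k arbitrary: f g)
  case (Suc k)
  note f = C_k_SucD[OF Suc.prems(1)] and g = C_k_SucD[OF Suc.prems(2)]
  show ?case
    by (rule C_k_SucI[OF has_derivative_mult[OF f(1) g(1)]])
       (intro C_k_add Suc.IH f(2) g(2) C_k_mono[OF Suc.prems(1)] C_k_mono[OF Suc.prems(2)])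
qed (auto intro!: continuous_intros)

text \<open>
  The family \<open>p(1/t) exp(-1/t)\<close>, extended by \<open>0\<close> to \<open>t \<le> 0\<close>, is closed under differentiation. Carrying
  the polynomial as a parameter turns smoothness of \<open>exp(-1/t)\<close> into a plain induction.
\<close>

definition flat_exp :: "real poly \<Rightarrow> real \<Rightarrow> real" where
  "flat_exp p t = (if t > 0 then poly p (1/t) * exp (- (1/t)) else 0)"

lemma flat_exp_tendsto_0: "(flat_exp p \<longlongrightarrow> 0) (at 0)"
proof -
  have *: "((\<lambda>s. poly p s * exp (- s)) \<longlongrightarrow> 0) at_top"
  proof -
    have "((\<lambda>s. \<Sum>i\<le>degree p. coeff p i * (s ^ i / exp s)) \<longlongrightarrow> (\<Sum>i\<le>degree p. coeff p i * 0)) at_top"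
      by (intro tendsto_intros tendsto_power_div_exp_0)
    then show ?thesis
      by (simp add: poly_altdef sum_distrib_right exp_minus field_simps sum_divide_distrib)
  qed
  have r: "(flat_exp p \<longlongrightarrow> 0) (at_right 0)"
  proof (rule tendsto_cong[THEN iffD1])
    show "((\<lambda>t. poly p (inverse t) * exp (- inverse t)) \<longlongrightarrow> 0) (at_right 0)"
      using filterlim_compose[OF * filterlim_inverse_at_top_right] .
    show "\<forall>\<^sub>F t in at_right 0. poly p (inverse t) * exp (- inverse t) = flat_exp p t"
      by (auto simp: flat_exp_def eventually_at_filter inverse_eq_divide)
  qed
  have l: "(flat_exp p \<longlongrightarrow> 0) (at_left 0)"
    by (rule tendsto_eventually) (auto simp: flat_exp_def eventually_at_filter)
  show ?thesis using l r by (simp add: filterlim_at_split)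
qed

text \<open>
  At \<open>t = 0\<close> the difference quotient is again a member of the family, with \<open>p\<close> multiplied by the
  variable, so its limit is covered by \<open>flat_exp_tendsto_0\<close>.
\<close>

lemma DERIV_flat_exp: "(flat_exp p has_real_derivative flat_exp ([:0,0,1:] * (p - pderiv p)) t) (at t)"
proof -
  consider "t > 0" | "t < 0" | "t = 0" by linarith
  then show ?thesis
  proof cases
    case 1
    have "((\<lambda>t. poly p (1/t) * exp (- (1/t))) has_real_derivative flat_exp ([:0,0,1:] * (p - pderiv p)) t) (at t)"
      using 1 by (auto intro!: derivative_eq_intros simp: flat_exp_def field_simps power2_eq_square)
    then show ?thesis
      by (rule has_field_derivative_transform_within_open[where S = "{0<..}"]) (use 1 in \<open>auto simp: flat_exp_def\<close>)
  next
    case 2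
    have "((\<lambda>_. 0) has_real_derivative flat_exp ([:0,0,1:] * (p - pderiv p)) t) (at t)"
      using 2 by (auto simp: flat_exp_def)
    then show ?thesis
      by (rule has_field_derivative_transform_within_open[where S = "{..<0}"]) (use 2 in \<open>auto simp: flat_exp_def\<close>)
  next
    case 3
    have "((\<lambda>y. flat_exp (pCons 0 p) y) \<longlongrightarrow> 0) (at 0)" by (rule flat_exp_tendsto_0)
    then have "((\<lambda>y. (flat_exp p y - flat_exp p 0) / (y - 0)) \<longlongrightarrow> 0) (at 0)"
      by (rule tendsto_cong[THEN iffD1, rotated]) (auto simp: flat_exp_def eventually_at_filter)
    then show ?thesis unfolding has_field_derivative_iff 3 by (simp add: flat_exp_def)
  qed
qed

definition bump :: "'a::euclidean_space \<Rightarrow> real" where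
  "bump x = flat_exp 1 (1/4 - x \<bullet> x)"

lemma C_k_bump: "C_k k (\<lambda>x::'a::euclidean_space. flat_exp p (1/4 - x \<bullet> x))"
proof (induction k arbitrary: p)
  case 0
  have "continuous_on UNIV (flat_exp p)"
    by (intro continuous_at_imp_continuous_on ballI DERIV_isCont[OF DERIV_flat_exp])
  then show ?case
    by (auto intro!: continuous_on_compose2[where f = "\<lambda>x. 1/4 - x \<bullet> x" and g = "flat_exp p"] continuous_intros)
next
  case (Suc k)
  have d: "((\<lambda>x::'a. flat_exp p (1/4 - x \<bullet> x)) has_derivative
      (\<lambda>h. flat_exp ([:0,0,1:] * (p - pderiv p)) (1/4 - x \<bullet> x) * ((x \<bullet> h) * (-2)))) (at x)" for x
    by (rule has_derivative_eq_rhs,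
        rule has_derivative_compose[of "\<lambda>x. 1/4 - x \<bullet> x" _ x UNIV "flat_exp p", OF _ DERIV_flat_exp[unfolded has_field_derivative_def]])
       (auto intro!: derivative_eq_intros simp: inner_commute algebra_simps)
  show ?case
    by (rule C_k_SucI[OF d]) (intro C_k_mult Suc.IH C_k_inner_left C_k_const)
qed

lemma smooth_bump: "smooth bump"
  unfolding smooth_def bump_def by (auto intro: C_k_bump)

lemma bump_nonneg: "bump x \<ge> 0" by (auto simp: bump_def flat_exp_def)

lemma bump_pos: "norm x < 1/2 \<Longrightarrow> bump x > 0"
  using power_strict_mono[of "norm x" "1/2" 2]
  by (auto simp: bump_def flat_exp_def dot_square_norm power_divide)

lemma bump_eq_0: "norm x \<ge> 1/2 \<Longrightarrow> bump x = 0"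
  using power_mono[of "1/2" "norm x" 2]
  by (auto simp: bump_def flat_exp_def dot_square_norm power_divide)

lemma bump_minus: "bump (x - y) = bump (y - x)"
  by (simp add: bump_def inner_diff_left inner_diff_right inner_commute algebra_simps)

section \<open>Convolution with a smooth kernel of compact support\<close>

lemma frechet_derivative_outside_support:
  fixes \<phi> :: "'a::euclidean_space \<Rightarrow> real"
  assumes "\<And>x. norm x > r \<Longrightarrow> \<phi> x = 0" "norm x > r"
  shows "frechet_derivative \<phi> (at x) = (\<lambda>h. 0)"
proof -
  have "(\<phi> has_derivative (\<lambda>h. 0)) (at x)"
    by (rule has_derivative_transform_within_open[where f = "\<lambda>_. 0" and s = "{x. norm x > r}"])
       (use assms in \<open>auto intro!: open_Collect_less continuous_intros\<close>)
  then show ?thesis using frechet_derivative_at by metis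
qed

lemma continuous_compact_support_bounded:
  fixes \<phi> :: "'a::euclidean_space \<Rightarrow> real"
  assumes "continuous_on UNIV \<phi>" "\<And>x. norm x > r \<Longrightarrow> \<phi> x = 0"
  obtains M where "M \<ge> 0" "\<And>x. \<bar>\<phi> x\<bar> \<le> M"
proof -
  have "bounded (\<phi> ` cball 0 r)"
    by (intro compact_imp_bounded compact_continuous_image continuous_on_subset[OF assms(1)]) auto
  then obtain M where M: "\<forall>x\<in>cball 0 r. \<bar>\<phi> x\<bar> \<le> M"
    unfolding bounded_iff by auto
  have "\<bar>\<phi> x\<bar> \<le> max M 0" for x
    using M assms(2)[of x] by (cases "norm x > r") (auto simp: not_less le_max_iff_disj)
  then show ?thesis using that[of "max M 0"] by auto
qed

text \<open>
  Each partial derivative is continuous with compact support, hence bounded; the mean value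
  inequality turns the bound on the derivative into a Lipschitz bound. Both are needed as
  dominating constants when differentiating under the integral sign.
\<close>

lemma C_1_compact_support_derivative_bound:
  fixes \<phi> :: "'a::euclidean_space \<Rightarrow> real"
  assumes "C_k 1 \<phi>" "\<And>x. norm x > r \<Longrightarrow> \<phi> x = 0"
  obtains L where "L \<ge> 0" "\<And>x h. \<bar>frechet_derivative \<phi> (at x) h\<bar> \<le> L * norm h"
    "\<And>x y. \<bar>\<phi> x - \<phi> y\<bar> \<le> L * norm (x - y)"
proof -
  let ?D = "\<lambda>x. frechet_derivative \<phi> (at x)"
  have d: "(\<phi> has_derivative ?D x) (at x)" for x
    using C_k_SucD[of 0 \<phi>] assms(1) by simp
  have "\<exists>M\<ge>0. \<forall>x. \<bar>?D x b\<bar> \<le> M" for b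
  proof -
    have "continuous_on UNIV (\<lambda>x. ?D x b)" using assms(1) by simp
    moreover have "?D x b = 0" if "norm x > r" for x
      using frechet_derivative_outside_support[of r \<phi> x] assms(2) that by simp
    ultimately show ?thesis
      using continuous_compact_support_bounded[of "\<lambda>x. ?D x b" r] by metis
  qed
  then obtain M where M: "\<And>b. M b \<ge> 0" "\<And>b x. \<bar>?D x b\<bar> \<le> M b" by metis
  define L where "L = (\<Sum>b\<in>Basis. M b)"
  have L: "L \<ge> 0" unfolding L_def by (intro sum_nonneg M)
  have D: "\<bar>?D x h\<bar> \<le> L * norm h" for x h
  proof -
    have lin: "linear (?D x)" using has_derivative_linear[OF d] .
    have "?D x h = ?D x (\<Sum>b\<in>Basis. (h \<bullet> b) *\<^sub>R b)" by (simp add: euclidean_representation)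
    also have "\<dots> = (\<Sum>b\<in>Basis. (h \<bullet> b) * ?D x b)"
      by (simp add: linear_sum[OF lin] linear_cmul[OF lin])
    also have "\<bar>\<dots>\<bar> \<le> (\<Sum>b\<in>Basis. norm h * M b)"
      by (rule order.trans[OF sum_abs])
         (auto intro!: sum_mono mult_mono M simp: abs_mult Basis_le_norm)
    finally show ?thesis by (simp add: L_def sum_distrib_left mult.commute)
  qed
  have "\<bar>\<phi> x - \<phi> y\<bar> \<le> L * norm (x - y)" for x y
  proof -
    have "norm (\<phi> x - \<phi> y) \<le> L * norm (x - y)"
      by (rule differentiable_bound[where S = UNIV and f' = ?D])
         (auto intro!: onorm_bound D L simp: d)
    then show ?thesis by simp
  qed
  with L D that show ?thesis by blast
qed

definition convolve :: "('a::euclidean_space \<Rightarrow> real) \<Rightarrow> ('a \<Rightarrow> 'b::euclidean_space) \<Rightarrow> 'a \<Rightarrow> 'b" where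
  "convolve \<phi> g x = (LINT y|lborel. \<phi> (x - y) *\<^sub>R g y)"

lemma emeasure_cball_less_top: "emeasure lborel (cball (c::'a::euclidean_space) r) < \<top>"
  using emeasure_bounded_finite[of "cball c r"] by simp

lemma integrable_compact_support:
  fixes f :: "'a::euclidean_space \<Rightarrow> 'b::euclidean_space"
  assumes "f \<in> borel_measurable borel" "\<And>y. norm (f y) \<le> M" "\<And>y. y \<notin> cball c r \<Longrightarrow> f y = 0"
  shows "integrable lborel f"
proof -
  have "integrable lborel (\<lambda>y. indicator (cball c r) y *\<^sub>R M :: real)"
    using emeasure_bounded_finite[of "cball c r"] by (simp add: less_top)
  then show ?thesis
    by (rule Bochner_Integration.integrable_bound)
       (use assms order.trans[OF norm_ge_zero assms(2)] in \<open>auto split: split_indicator\<close>)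
qed

context
  fixes g :: "'a::euclidean_space \<Rightarrow> 'b::euclidean_space" and B :: real
  assumes g_measurable: "g \<in> borel_measurable borel" and g_bound: "\<And>y. norm (g y) \<le> B"
begin

lemma B_nonneg: "B \<ge> 0" using order.trans[OF norm_ge_zero g_bound] .

lemma convolve_integrable:
  assumes "continuous_on UNIV \<phi>" "\<And>x. norm x > r \<Longrightarrow> \<phi> x = 0"
  shows "integrable lborel (\<lambda>y. \<phi> (x - y) *\<^sub>R g y)"
proof -
  obtain M where M: "M \<ge> 0" "\<And>x. \<bar>\<phi> x\<bar> \<le> M"
    using continuous_compact_support_bounded[OF assms] by blast
  have [measurable]: "\<phi> \<in> borel_measurable borel" by (rule borel_measurable_continuous_onI[OF assms(1)])
  note g_measurable[measurable]
  show ?thesis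
    by (rule integrable_compact_support[where M = "M * B" and c = x and r = r])
       (use assms(2) in \<open>auto intro!: mult_mono M g_bound B_nonneg simp: dist_norm\<close>)
qed

text \<open>
  The constant depends on the convolved function \<open>g\<close> only through its bound \<open>B\<close>. This uniformity is what
  makes all realizations of the random field share one Lipschitz constant.
\<close>

lemma convolve_Lipschitz:
  assumes "C_k 1 \<phi>" "\<And>x. norm x > r \<Longrightarrow> \<phi> x = 0" "L \<ge> 0" "\<And>x y. \<bar>\<phi> x - \<phi> y\<bar> \<le> L * norm (x - y)"
  shows "norm (convolve \<phi> g x - convolve \<phi> g x') \<le> 2 * L * B * measure lborel (cball (0::'a) r) * norm (x - x')"
proof -
  have cont: "continuous_on UNIV \<phi>" using C_k_mono[of 0 \<phi>] assms(1) by simp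
  note int = convolve_integrable[OF cont assms(2)]
  have m: "measure lborel (cball x r) = measure lborel (cball (0::'a) r)" for x :: 'a
    by (cases "r \<ge> 0") (simp_all add: content_cball)
  have "norm (convolve \<phi> g x - convolve \<phi> g x') = norm (LINT y|lborel. \<phi> (x - y) *\<^sub>R g y - \<phi> (x' - y) *\<^sub>R g y)"
    unfolding convolve_def by (simp add: int)
  also have "\<dots> \<le> (LINT y|lborel. (indicator (cball x r) y + indicator (cball x' r) y) * (L * norm (x - x') * B))"
  proof (rule Bochner_Integration.integral_norm_bound_integral)
    show "integrable lborel (\<lambda>y. \<phi> (x - y) *\<^sub>R g y - \<phi> (x' - y) *\<^sub>R g y)" using int by auto
    show "integrable lborel (\<lambda>y. (indicator (cball x r) y + indicator (cball x' r) y) * (L * norm (x - x') * B))"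
      by (intro integrable_mult_left Bochner_Integration.integrable_add integrable_real_indicator)
         (simp_all add: emeasure_cball_less_top emeasure_cball_less_top[THEN less_imp_neq])
    fix y
    have "norm (\<phi> (x - y) *\<^sub>R g y - \<phi> (x' - y) *\<^sub>R g y) = \<bar>\<phi> (x - y) - \<phi> (x' - y)\<bar> * norm (g y)"
      by (simp flip: scaleR_diff_left)
    also have "\<dots> \<le> (L * norm (x - x')) * B"
      using assms(4)[of "x - y" "x' - y"] by (intro mult_mono g_bound) (auto intro: assms(3))
    finally have *: "norm (\<phi> (x - y) *\<^sub>R g y - \<phi> (x' - y) *\<^sub>R g y) \<le> (L * norm (x - x')) * B" .
    have "0 \<le> (L * norm (x - x')) * B" using assms(3) B_nonneg by simp
    with * show "norm (\<phi> (x - y) *\<^sub>R g y - \<phi> (x' - y) *\<^sub>R g y)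
        \<le> (indicator (cball x r) y + indicator (cball x' r) y) * (L * norm (x - x') * B)"
      using assms(2)[of "x - y"] assms(2)[of "x' - y"]
      by (auto split: split_indicator simp: dist_norm not_le)
  qed
  also have "\<dots> = (measure lborel (cball x r) + measure lborel (cball x' r)) * (L * norm (x - x') * B)"
    by (simp add: emeasure_cball_less_top emeasure_cball_less_top[THEN less_imp_neq])
  also have "\<dots> = 2 * L * B * measure lborel (cball (0::'a) r) * norm (x - x')"
    by (simp add: m[of x] m[of x'])
  finally show ?thesis .
qed

text \<open>
  Differentiation falls on the kernel. The normalized remainders tend to \<open>0\<close> pointwise, are bounded by twice the
  Lipschitz constant of the kernel, and vanish outside a fixed ball, so dominated convergence
  applies along every sequence of increments.
\<close>

lemma convolve_has_derivative:
  assumes "C_k 1 \<phi>" "\<And>x. norm x > r \<Longrightarrow> \<phi> x = 0"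
  shows "(convolve \<phi> g has_derivative (\<lambda>h. convolve (\<lambda>x. frechet_derivative \<phi> (at x) h) g x)) (at x)"
proof -
  let ?D = "\<lambda>x. frechet_derivative \<phi> (at x)"
  obtain L where L: "L \<ge> 0" "\<And>x h. \<bar>?D x h\<bar> \<le> L * norm h" "\<And>x y. \<bar>\<phi> x - \<phi> y\<bar> \<le> L * norm (x - y)"
    using C_1_compact_support_derivative_bound[OF assms] by blast
  have d: "(\<phi> has_derivative ?D x) (at x)" for x
    using C_k_SucD[of 0 \<phi>] assms(1) by simp
  have cont: "continuous_on UNIV \<phi>" using C_k_mono[of 0 \<phi>] assms(1) by simp
  have contD: "continuous_on UNIV (\<lambda>x. ?D x h)" for h using assms(1) by simp
  have suppD: "?D x h = 0" if "norm x > r" for x h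
    using frechet_derivative_outside_support[of r \<phi> x] assms(2) that by simp
  note int = convolve_integrable[OF cont assms(2)]
  note intD = convolve_integrable[OF contD suppD]
  note [measurable] = borel_measurable_continuous_onI[OF cont] borel_measurable_continuous_onI[OF contD] g_measurable
  have linD: "linear (?D x)" for x using has_derivative_linear[OF d] .
  have "linear (\<lambda>h. convolve (\<lambda>x. ?D x h) g x)"
  proof
    fix h k :: 'a and c :: real
    show "convolve (\<lambda>x. ?D x (h + k)) g x = convolve (\<lambda>x. ?D x h) g x + convolve (\<lambda>x. ?D x k) g x"
      unfolding convolve_def by (simp add: linear_add[OF linD] scaleR_add_left intD)
    show "convolve (\<lambda>x. ?D x (c *\<^sub>R h)) g x = c *\<^sub>R convolve (\<lambda>x. ?D x h) g x"
      unfolding convolve_def by (simp add: linear_cmul[OF linD] flip: scaleR_scaleR)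
  qed
  then have "bounded_linear (\<lambda>h. convolve (\<lambda>x. ?D x h) g x)" by (simp add: linear_conv_bounded_linear)
  moreover have "((\<lambda>h. norm (convolve \<phi> g (x + h) - convolve \<phi> g x - convolve (\<lambda>x. ?D x h) g x) / norm h) \<longlongrightarrow> 0) (at 0)"
    unfolding tendsto_at_iff_sequentially
  proof (intro allI impI)
    fix X :: "nat \<Rightarrow> 'a" assume X: "\<forall>i. X i \<in> UNIV - {0}" "X \<longlonglongrightarrow> 0"
    then have nz: "X i \<noteq> 0" for i by auto
    obtain K where K: "\<And>i. norm (X i) \<le> K"
      using convergent_imp_Bseq[OF convergentI[OF X(2)]] by (auto simp: Bseq_def)
    define q where "q i y = ((\<phi> (x + X i - y) - \<phi> (x - y) - ?D (x - y) (X i)) / norm (X i))" for i y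
    have q_bound: "\<bar>q i y\<bar> \<le> 2 * L" for i y
    proof -
      have "\<bar>\<phi> (x + X i - y) - \<phi> (x - y) - ?D (x - y) (X i)\<bar> \<le> L * norm (X i) + L * norm (X i)"
        using L(3)[of "x + X i - y" "x - y"] L(2)[of "x - y" "X i"] by simp
      then show ?thesis using nz[of i] by (simp add: q_def divide_simps)
    qed
    have q_lim: "(\<lambda>i. q i y) \<longlonglongrightarrow> 0" for y
    proof -
      have "((\<lambda>h. norm (\<phi> ((x - y) + h) - \<phi> (x - y) - ?D (x - y) h) / norm h) \<longlongrightarrow> 0) (at 0)"
        using d[of "x - y"] unfolding has_derivative_at by blast
      then have "((\<lambda>h. norm (\<phi> ((x - y) + h) - \<phi> (x - y) - ?D (x - y) h) / norm h) \<circ> X) \<longlonglongrightarrow> 0"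
        using X unfolding tendsto_at_iff_sequentially by blast
      then have "(\<lambda>i. norm (q i y)) \<longlonglongrightarrow> 0"
        by (simp add: q_def o_def algebra_simps)
      then show ?thesis by (rule tendsto_norm_zero_cancel)
    qed
    have q_supp: "q i y = 0" if "y \<notin> cball x (r + K)" for i y
    proof -
      have "norm (x - y) > r + K" using that by (simp add: dist_norm)
      moreover have "norm (x - y) \<le> norm (x + X i - y) + norm (X i)"
        using norm_triangle_ineq4[of "x + X i - y" "X i"] by simp
      ultimately have "norm (x - y) > r" "norm (x + X i - y) > r"
        using K[of i] norm_ge_zero[of "X i"] by linarith+
      then show ?thesis unfolding q_def using assms(2) suppD by simp
    qed
    have [measurable]: "q i \<in> borel_measurable borel" for i unfolding q_def by measurable
    have "(\<lambda>i. LINT y|lborel. q i y *\<^sub>R g y) \<longlonglongrightarrow> (LINT (y::'a)|lborel. (0::'b))"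
    proof (rule integral_dominated_convergence)
      show "integrable lborel (\<lambda>y. indicator (cball x (r + K)) y * (2 * L * B))"
        by (intro integrable_mult_left integrable_real_indicator) (simp_all add: emeasure_cball_less_top emeasure_cball_less_top[THEN less_imp_neq])
      show "AE y in lborel. (\<lambda>i. q i y *\<^sub>R g y) \<longlonglongrightarrow> 0"
        using tendsto_scaleR[OF q_lim tendsto_const] by auto
      show "AE y in lborel. norm (q i y *\<^sub>R g y) \<le> indicator (cball x (r + K)) y * (2 * L * B)" for i
      proof (rule AE_I2)
        fix y show "norm (q i y *\<^sub>R g y) \<le> indicator (cball x (r + K)) y * (2 * L * B)"
          using mult_mono[OF q_bound[of i y] g_bound[of y]] q_supp[of y i] L(1)
          by (auto split: split_indicator)
      qed
    qed auto
    then have "(\<lambda>i. norm (LINT y|lborel. q i y *\<^sub>R g y)) \<longlonglongrightarrow> 0"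
      using tendsto_norm_zero by simp
    moreover have "norm (LINT y|lborel. q i y *\<^sub>R g y)
        = norm (convolve \<phi> g (x + X i) - convolve \<phi> g x - convolve (\<lambda>x. ?D x (X i)) g x) / norm (X i)" for i
    proof -
      have "q i y *\<^sub>R g y = inverse (norm (X i)) *\<^sub>R (\<phi> (x + X i - y) *\<^sub>R g y - \<phi> (x - y) *\<^sub>R g y - ?D (x - y) (X i) *\<^sub>R g y)" for y
        by (simp add: q_def scaleR_diff_left scaleR_diff_right divide_inverse algebra_simps)
      then have "(LINT y|lborel. q i y *\<^sub>R g y)
          = inverse (norm (X i)) *\<^sub>R (LINT y|lborel. \<phi> (x + X i - y) *\<^sub>R g y - \<phi> (x - y) *\<^sub>R g y - ?D (x - y) (X i) *\<^sub>R g y)"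
        by simp
      also have "\<dots> = inverse (norm (X i)) *\<^sub>R (convolve \<phi> g (x + X i) - convolve \<phi> g x - convolve (\<lambda>x. ?D x (X i)) g x)"
        unfolding convolve_def by (simp add: int intD)
      finally show ?thesis by (simp add: divide_inverse mult.commute)
    qed
    ultimately show "((\<lambda>h. norm (convolve \<phi> g (x + h) - convolve \<phi> g x - convolve (\<lambda>x. ?D x h) g x) / norm h) \<circ> X) \<longlonglongrightarrow> 0"
      by (simp add: o_def)
  qed
  ultimately show ?thesis unfolding has_derivative_at by blast
qed

text \<open>
  The directional derivatives of the kernel are again smooth and vanish outside the same ball,
  so the induction runs over all kernels of this class at once.
\<close>

lemma C_k_convolve:
  assumes "smooth \<phi>" "\<And>x. norm x > r \<Longrightarrow> \<phi> x = 0"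
  shows "C_k k (convolve \<phi> g)"
  using assms
proof (induction k arbitrary: \<phi>)
  case (0 \<phi>)
  have "C_k 1 \<phi>" using 0(1) by (simp only: smooth_def)
  from convolve_has_derivative[OF this 0(2)] show ?case
    by (auto intro!: continuous_at_imp_continuous_on has_derivative_continuous)
next
  case (Suc k \<phi>)
  have C: "C_k n \<phi>" for n using Suc.prems(1) by (simp only: smooth_def)
  show ?case
  proof (rule C_k_SucI[OF convolve_has_derivative[OF C Suc.prems(2)]])
    fix h
    show "C_k k (convolve (\<lambda>x. frechet_derivative \<phi> (at x) h) g)"
      by (rule Suc.IH)
         (use C_k_SucD(2)[OF C] frechet_derivative_outside_support[of r \<phi>] Suc.prems(2) in \<open>auto simp: smooth_def\<close>)
  qed auto
qed

end

lemma lborel_integral_translate: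
  fixes f :: "'a::euclidean_space \<Rightarrow> 'b::euclidean_space"
  assumes [measurable]: "f \<in> borel_measurable borel"
  shows "(LINT y|lborel. f (a + y)) = (LINT y|lborel. f y)"
proof -
  have "(LINT y|lborel. f y) = (LINT y|distr lborel borel ((+) a). f y)" by (simp add: lborel_distr_plus)
  also have "\<dots> = (LINT y|lborel. f (a + y))" by (simp add: integral_distr)
  finally show ?thesis by simp
qed

lemma bump_continuous: "continuous_on UNIV bump"
  using smooth_bump unfolding smooth_def by (metis C_k.simps(1))

lemma bump_outside: "norm x > 1/2 \<Longrightarrow> bump x = 0"
  by (rule bump_eq_0) simp

lemma bump_integrable: "integrable lborel (\<lambda>y. bump (y::'a::euclidean_space))"
proof -
  obtain M where "M \<ge> 0" "\<And>x::'a. \<bar>bump x\<bar> \<le> M"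
    using continuous_compact_support_bounded[OF bump_continuous bump_outside] by blast
  then show ?thesis
    by (intro integrable_compact_support[where M = M and c = 0 and r = "1/2"] borel_measurable_continuous_onI bump_continuous)
       (auto intro!: bump_outside)
qed

lemma bump_integral_pos: "(LINT y|lborel. bump (y::'a::euclidean_space)) > 0"
proof (rule ccontr)
  assume "\<not> ?thesis"
  then have "(LINT y|lborel. bump (y::'a)) = 0"
    using Bochner_Integration.integral_nonneg[of "lborel :: 'a measure" bump, OF bump_nonneg]
    by linarith
  then have "AE y in lborel. bump (y::'a) = 0"
    by (subst (asm) integral_nonneg_eq_0_iff_AE) (auto intro: bump_integrable bump_nonneg)
  then have "AE y in lborel. (y::'a) \<notin> ball 0 (1/2)"
    by eventually_elim (use bump_pos in force)
  then have "emeasure lborel (ball (0::'a) (1/2)) = 0"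
    by (subst (asm) AE_iff_measurable[OF _ refl]) (auto simp: ball_def)
  moreover have "emeasure lborel (ball (0::'a) (1/2)) > 0" by (simp add: emeasure_ball)
  ultimately show False by simp
qed

section \<open>Integral curves of bounded Lipschitz fields\<close>

lemma at_within_atLeast_atMost:
  fixes t :: real
  assumes "t < c"
  shows "at t within {a..} = at t within {a..c}"
  by (rule at_within_nhd[where S = "{..<c}"]) (use assms in auto)

lemma integral_from_0_has_vector_derivative:
  fixes f :: "real \<Rightarrow> 'a::banach"
  assumes "continuous_on UNIV f" "t \<ge> 0"
  shows "((\<lambda>s. integral {0..s} f) has_vector_derivative f t) (at t within {0..})"
  unfolding at_within_atLeast_atMost[of t "t + 1" 0, simplified]
  by (rule integral_has_vector_derivative) (use assms in \<open>auto intro: continuous_on_subset\<close>)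

text \<open>
  Picard iteration on the whole half-line at once: writing \<open>\<gamma> t = z + exp (2 L t) g t\<close>, the integral
  equation becomes a fixed point equation for a bounded continuous \<open>g\<close>, and the exponential
  weight makes its right-hand side a contraction with factor \<open>1/2\<close>.
\<close>

lemma Lipschitz_field_solution:
  fixes v :: "'a::euclidean_space \<Rightarrow> 'a"
  assumes L: "L > 0" "\<And>x y. norm (v x - v y) \<le> L * norm (x - y)" and B: "\<And>x. norm (v x) \<le> B"
  obtains \<gamma> where "\<gamma> 0 = z" "\<And>t. t \<ge> 0 \<Longrightarrow> (\<gamma> has_vector_derivative v (\<gamma> t)) (at t within {0..})"
proof -
  have B0: "B \<ge> 0" using order.trans[OF norm_ge_zero B] .
  have "L-lipschitz_on UNIV v"
    using L by (auto simp: lipschitz_on_def dist_norm)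
  then have contv: "continuous_on UNIV v" by (rule lipschitz_on_continuous_on)
  define f :: "(real \<Rightarrow>\<^sub>C 'a) \<Rightarrow> real \<Rightarrow> 'a" where
    "f g u = v (z + exp (2 * L * u) *\<^sub>R g u)" for g u
  define T where "T g t = exp (- (2 * L * max t 0)) *\<^sub>R integral {0..max t 0} (f g)" for g t
  have contf: "continuous_on UNIV (f g)" for g
    unfolding f_def by (intro continuous_on_compose2[OF contv] continuous_intros) auto
  have intf: "f g integrable_on {0..s}" for g s
    by (rule integrable_continuous_interval) (rule continuous_on_subset[OF contf], simp)
  have dP: "((\<lambda>s. integral {0..s} (f g)) has_vector_derivative f g t) (at t within {0..})" if "t \<ge> 0" for g t
    by (rule integral_from_0_has_vector_derivative[OF contf that])
  have contP: "continuous_on {0..} (\<lambda>s. integral {0..s} (f g))" for g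
    by (rule continuous_on_vector_derivative) (use dP in auto)
  have contT: "continuous_on UNIV (T g)" for g
    unfolding T_def
    by (intro continuous_intros continuous_on_compose2[OF contP, of UNIV "\<lambda>t. max t 0"]) auto
  have boundT: "norm (T g t) \<le> B / (2 * L)" for g t
  proof -
    define s where "s = max t 0"
    have s: "s \<ge> 0" by (simp add: s_def)
    have "norm (integral {0..s} (f g)) \<le> B * (s - 0)"
      by (rule integral_bound) (use s B in \<open>auto simp: f_def intro: continuous_on_subset[OF contf[unfolded f_def]]\<close>)
    then have "norm (T g t) \<le> exp (- (2 * L * s)) * (B * s)"
      by (simp add: T_def s_def[symmetric])
    also have "2 * L * s \<le> exp (2 * L * s)" using exp_ge_add_one_self[of "2 * L * s"] by linarith
    then have "s * exp (- (2 * L * s)) \<le> 1 / (2 * L)"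
      using L(1) by (simp add: exp_minus field_simps)
    then have "B * (s * exp (- (2 * L * s))) \<le> B * (1 / (2 * L))"
      by (rule mult_left_mono[OF _ B0])
    then have "exp (- (2 * L * s)) * (B * s) \<le> B / (2 * L)" by (simp add: mult_ac)
    finally show ?thesis .
  qed
  have T_bcontfun: "T g \<in> bcontfun" for g
    by (rule bcontfun_normI[OF contT boundT])
  \<comment> \<open>The factor \<open>1/2\<close> comes from integrating the weight \<open>L exp (2 L u)\<close> against \<open>exp (- 2 L s)\<close>.\<close>
  have T_contr: "norm (T g t - T h t) \<le> 1/2 * dist g h" for g h t
  proof -
    define s where "s = max t 0"
    have s: "s \<ge> 0" by (simp add: s_def)
    have ebd: "((\<lambda>u. L * exp (2 * L * u) * dist g h) has_integral
        exp (2 * L * s) / 2 * dist g h - exp (2 * L * 0) / 2 * dist g h) {0..s}"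
      by (rule fundamental_theorem_of_calculus[OF s])
         (auto intro!: derivative_eq_intros simp flip: has_real_derivative_iff_has_vector_derivative)
    have "norm (integral {0..s} (f g) - integral {0..s} (f h)) = norm (integral {0..s} (\<lambda>u. f g u - f h u))"
      by (simp add: integral_diff intf)
    also have "\<dots> \<le> integral {0..s} (\<lambda>u. L * exp (2 * L * u) * dist g h)"
    proof (rule integral_norm_bound_integral)
      show "(\<lambda>u. f g u - f h u) integrable_on {0..s}" by (intro integrable_diff intf)
      show "(\<lambda>u. L * exp (2 * L * u) * dist g h) integrable_on {0..s}" using ebd by blast
      fix u
      have "norm (f g u - f h u) \<le> L * norm (exp (2 * L * u) *\<^sub>R (g u - h u))"
        unfolding f_def using L(2)[of "z + exp (2 * L * u) *\<^sub>R g u" "z + exp (2 * L * u) *\<^sub>R h u"]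
        by (simp add: scaleR_diff_right)
      also have "\<dots> \<le> L * (exp (2 * L * u) * dist g h)"
        using dist_bounded[of g u h] L(1) by (auto simp: dist_norm)
      finally show "norm (f g u - f h u) \<le> L * exp (2 * L * u) * dist g h" by simp
    qed
    also have "\<dots> = (exp (2 * L * s) - 1) / 2 * dist g h"
      using integral_unique[OF ebd] by (simp add: algebra_simps diff_divide_distrib)
    finally have *: "norm (integral {0..s} (f g) - integral {0..s} (f h)) \<le> (exp (2 * L * s) - 1) / 2 * dist g h" .
    have "norm (T g t - T h t) = exp (- (2 * L * s)) * norm (integral {0..s} (f g) - integral {0..s} (f h))"
      unfolding T_def s_def[symmetric] by (simp flip: scaleR_diff_right)
    also have "\<dots> \<le> exp (- (2 * L * s)) * ((exp (2 * L * s) - 1) / 2 * dist g h)"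
      by (rule mult_left_mono[OF *]) simp
    also have "\<dots> = (1 - exp (- (2 * L * s))) * (1 / 2 * dist g h)"
      by (simp add: algebra_simps exp_minus diff_divide_distrib)
    also have "\<dots> \<le> 1 * (1/2 * dist g h)" by (rule mult_right_mono) auto
    finally show ?thesis by simp
  qed
  define TT where "TT g = Bcontfun (T g)" for g
  have TT: "apply_bcontfun (TT g) = T g" for g
    unfolding TT_def by (rule Bcontfun_inverse[OF T_bcontfun])
  have "\<exists>!g. TT g = g"
  proof (rule banach_fix_type[of "1/2"])
    show "\<forall>g h. dist (TT g) (TT h) \<le> 1/2 * dist g h"
      by (intro allI dist_bound) (use T_contr in \<open>simp add: TT dist_norm[where 'a = 'a]\<close>)
  qed auto
  then obtain g where g: "T g = apply_bcontfun g" using TT by metis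
  define \<gamma> where "\<gamma> t = z + integral {0..t} (f g)" for t
  have \<gamma>: "\<gamma> t = z + exp (2 * L * t) *\<^sub>R g t" if "t \<ge> 0" for t
    using that by (simp add: \<gamma>_def g[symmetric] T_def max_def exp_minus)
  have "(\<gamma> has_vector_derivative v (\<gamma> t)) (at t within {0..})" if "t \<ge> 0" for t
  proof -
    have "(\<gamma> has_vector_derivative 0 + f g t) (at t within {0..})"
      unfolding \<gamma>_def by (intro has_vector_derivative_add has_vector_derivative_const dP that)
    then show ?thesis by (simp add: f_def \<gamma>[OF that])
  qed
  moreover have "\<gamma> 0 = z" by (simp add: \<gamma>_def)
  ultimately show ?thesis using that by blast
qed

text \<open>
  Gronwall's argument: \<open>exp (- 2 L t) |\<gamma> t - \<delta> t|\<^sup>2\<close> is nonincreasing and starts at \<open>0\<close>.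
\<close>

lemma Lipschitz_field_solution_unique:
  fixes v :: "'a::euclidean_space \<Rightarrow> 'a"
  assumes L: "\<And>x y. norm (v x - v y) \<le> L * norm (x - y)"
    and \<gamma>: "\<And>t. t \<ge> 0 \<Longrightarrow> (\<gamma> has_vector_derivative v (\<gamma> t)) (at t within {0..})"
    and \<delta>: "\<And>t. t \<ge> 0 \<Longrightarrow> (\<delta> has_vector_derivative v (\<delta> t)) (at t within {0..})"
    and start: "\<gamma> 0 = \<delta> 0" and t: "t \<ge> 0"
  shows "\<gamma> t = \<delta> t"
proof -
  define w where "w t = exp (- (2 * L * t)) * ((\<gamma> t - \<delta> t) \<bullet> (\<gamma> t - \<delta> t))" for t
  define w' where "w' t = exp (- (2 * L * t)) * (2 * ((\<gamma> t - \<delta> t) \<bullet> (v (\<gamma> t) - v (\<delta> t))) - 2 * L * ((\<gamma> t - \<delta> t) \<bullet> (\<gamma> t - \<delta> t)))" for t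
  have d: "(w has_real_derivative w' t) (at t within {0..})" if "t \<ge> 0" for t
  proof -
    have "((\<lambda>t. (\<gamma> t - \<delta> t) \<bullet> (\<gamma> t - \<delta> t)) has_derivative
        (\<lambda>h. (\<gamma> t - \<delta> t) \<bullet> (h *\<^sub>R v (\<gamma> t) - h *\<^sub>R v (\<delta> t)) + (h *\<^sub>R v (\<gamma> t) - h *\<^sub>R v (\<delta> t)) \<bullet> (\<gamma> t - \<delta> t)))
        (at t within {0..})"
      by (intro has_derivative_inner has_derivative_diff \<gamma>[OF that, unfolded has_vector_derivative_def]
            \<delta>[OF that, unfolded has_vector_derivative_def])
    then have "((\<lambda>t. (\<gamma> t - \<delta> t) \<bullet> (\<gamma> t - \<delta> t)) has_real_derivative
        2 * ((\<gamma> t - \<delta> t) \<bullet> (v (\<gamma> t) - v (\<delta> t)))) (at t within {0..})"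
      unfolding has_field_derivative_def
      by (rule has_derivative_eq_rhs)
         (auto simp: fun_eq_iff inner_commute simp flip: scaleR_diff_right)
    have "((\<lambda>t. exp (- (2 * L * t))) has_real_derivative - (2 * L) * exp (- (2 * L * t))) (at t within {0..})"
      by (auto intro!: derivative_eq_intros)
    from this \<open>((\<lambda>t. (\<gamma> t - \<delta> t) \<bullet> (\<gamma> t - \<delta> t)) has_real_derivative _) _\<close> show ?thesis
      unfolding w_def w'_def
      by (rule DERIV_cong[OF DERIV_mult]) (simp add: algebra_simps)
  qed
  have "w' t \<le> 0" if "t \<ge> 0" for t
  proof -
    have "(\<gamma> t - \<delta> t) \<bullet> (v (\<gamma> t) - v (\<delta> t)) \<le> norm (\<gamma> t - \<delta> t) * norm (v (\<gamma> t) - v (\<delta> t))"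
      by (rule norm_cauchy_schwarz)
    also have "\<dots> \<le> norm (\<gamma> t - \<delta> t) * (L * norm (\<gamma> t - \<delta> t))" by (intro mult_left_mono L) simp
    also have "\<dots> = L * ((\<gamma> t - \<delta> t) \<bullet> (\<gamma> t - \<delta> t))" by (simp add: dot_square_norm power2_eq_square)
    finally show ?thesis by (auto simp: w'_def mult_le_0_iff)
  qed
  moreover have "continuous_on {0..t} w"
    by (rule continuous_on_subset[of "{0..}"], rule DERIV_continuous_on[of _ _ w']) (use d in auto)
  moreover have "(w has_real_derivative w' s) (at s)" if "0 < s" for s
    using d[of s] that by (simp add: at_within_interior[of s "{0..}"])
  ultimately have "w t \<le> w 0"
    by (intro DERIV_nonpos_imp_decreasing_open[OF t])
       (meson less_imp_le, blast)
  then have "(\<gamma> t - \<delta> t) \<bullet> (\<gamma> t - \<delta> t) \<le> 0"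
    using start by (simp add: w_def mult_le_0_iff not_le[symmetric])
  then show ?thesis by (metis eq_iff_diff_eq_0 inner_eq_zero_iff inner_ge_zero order_antisym)
qed

lemma Lipschitz_field_integral_curve:
  assumes "L > 0" "\<And>x y. norm (v x - v y) \<le> L * norm (x - y)" "\<And>x. norm (v x) \<le> B"
  obtains \<gamma> where "integral_curve v z \<gamma>"
proof -
  obtain \<gamma> where \<gamma>: "\<gamma> 0 = z" "\<And>t. t \<ge> 0 \<Longrightarrow> (\<gamma> has_vector_derivative v (\<gamma> t)) (at t within {0..})"
    using Lipschitz_field_solution[of L v B z] assms by metis
  have "integral_curve v z \<gamma>"
    unfolding integral_curve_def solves_from_def
    using Lipschitz_field_solution_unique[of v L _ \<gamma>] assms(2) \<gamma> by (auto simp: Ball_def)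
  with that show ?thesis by blast
qed

section \<open>Curves that move up and to the right\<close>

text \<open>
  The coordinates of an integral curve enter as two real functions, in a formulation that is symmetric in
  them, so that every fact about horizontal barriers also serves for vertical ones.
\<close>

locale monotone_unit_curve =
  fixes a b a' b' :: "real \<Rightarrow> real"
  assumes a: "\<And>t. t \<ge> 0 \<Longrightarrow> (a has_real_derivative a' t) (at t within {0..})"
    and b: "\<And>t. t \<ge> 0 \<Longrightarrow> (b has_real_derivative b' t) (at t within {0..})"
    and a'_nonneg: "\<And>t. a' t \<ge> 0" and b'_nonneg: "\<And>t. b' t \<ge> 0" and sum_1: "\<And>t. a' t + b' t = 1"
begin

lemma swap: "monotone_unit_curve b a b' a'"
  using a b a'_nonneg b'_nonneg sum_1 by unfold_locales (auto simp: add.commute)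

lemma a_at: "t > 0 \<Longrightarrow> (a has_real_derivative a' t) (at t)"
  using a[of t] by (simp add: at_within_interior[of t "{0..}"])

lemma b_at: "t > 0 \<Longrightarrow> (b has_real_derivative b' t) (at t)"
  using b[of t] by (simp add: at_within_interior[of t "{0..}"])

lemma a_continuous: "0 \<le> s \<Longrightarrow> continuous_on {s..t} a"
  by (rule continuous_on_subset[of "{0..}"], rule DERIV_continuous_on[of _ _ a']) (use a in auto)

lemma b_continuous: "0 \<le> s \<Longrightarrow> continuous_on {s..t} b"
  by (rule continuous_on_subset[of "{0..}"], rule DERIV_continuous_on[of _ _ b']) (use b in auto)

lemma a_mono: "0 \<le> s \<Longrightarrow> s \<le> t \<Longrightarrow> a s \<le> a t"
  by (rule DERIV_nonneg_imp_increasing_open[of s t a])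
     (auto intro!: a_continuous a'_nonneg exI[of _ "a' _"] a_at)

lemma b_mono: "0 \<le> s \<Longrightarrow> s \<le> t \<Longrightarrow> b s \<le> b t"
  by (rule monotone_unit_curve.a_mono[OF swap])

lemma sum_eq: "t \<ge> 0 \<Longrightarrow> a t + b t = a 0 + b 0 + t"
proof -
  assume t: "t \<ge> 0"
  have "((\<lambda>t. a t + b t - t) has_real_derivative 0) (at s within {0..})" if "s \<ge> 0" for s
    using a[OF that] b[OF that] sum_1[of s] by (auto intro!: derivative_eq_intros)
  then obtain c where "\<And>s. s \<in> {0..} \<Longrightarrow> a s + b s - s = c"
    using has_field_derivative_zero_constant[of "{0..}" "\<lambda>t. a t + b t - t"] by auto
  from this[of 0] this[of t] show "a t + b t = a 0 + b 0 + t" using t by simp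
qed

text \<open>
  The barrier is the strip \<open>[\<alpha>, \<beta>] \<times> [h0, h1]\<close>. To get above it, \<open>b\<close> would have to
  climb from \<open>h0\<close> to \<open>h1\<close> during a time interval in which its derivative vanishes.
\<close>

lemma stays_below_barrier:
  assumes "h0 < h1" "\<alpha> \<le> a 0" "b 0 \<le> h0"
    and barrier: "\<And>t. t \<ge> 0 \<Longrightarrow> \<alpha> \<le> a t \<Longrightarrow> a t \<le> \<beta> \<Longrightarrow> h0 \<le> b t \<Longrightarrow> b t \<le> h1 \<Longrightarrow> b' t = 0"
    and t: "t \<ge> 0" "a t \<le> \<beta>"
  shows "b t \<le> h1"
proof (rule ccontr)
  assume "\<not> b t \<le> h1"
  then obtain s2 where s2: "0 \<le> s2" "s2 \<le> t" "b s2 = h1"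
    using IVT'[of b 0 h1 t] assms b_continuous[of 0 t] by auto
  then obtain s1 where s1: "0 \<le> s1" "s1 \<le> s2" "b s1 = h0"
    using IVT'[of b 0 h0 s2] assms b_continuous[of 0 s2] by auto
  have "s1 < s2" using s1 s2 assms(1) by (cases "s1 = s2") auto
  then obtain \<xi> where \<xi>: "s1 < \<xi>" "\<xi> < s2" "b s2 - b s1 = (s2 - s1) * b' \<xi>"
    using mvt[of s1 s2 b "\<lambda>x h. h * b' x"] b_continuous[of s1 s2] b_at s1
    by (auto simp: has_field_derivative_def mult_commute_abs)
  have "b' \<xi> = 0"
    using a_mono[of 0 \<xi>] a_mono[of \<xi> t] b_mono[of s1 \<xi>] b_mono[of \<xi> s2] \<xi> s1 s2 assms
    by (intro barrier) auto
  then show False using \<xi>(3) s1 s2 assms(1) by simp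
qed

text \<open>
  As \<open>a + b\<close> grows at unit speed while \<open>b\<close> is capped, \<open>a\<close> must reach the far end of the
  barrier.
\<close>

lemma carried_along_barrier:
  assumes "h0 < h1" "\<alpha> \<le> a 0" "a 0 \<le> \<beta>" "b 0 \<le> h0"
    and barrier: "\<And>t. t \<ge> 0 \<Longrightarrow> \<alpha> \<le> a t \<Longrightarrow> a t \<le> \<beta> \<Longrightarrow> h0 \<le> b t \<Longrightarrow> b t \<le> h1 \<Longrightarrow> b' t = 0"
  shows "\<exists>t\<ge>0. a t = \<beta> \<and> b t \<le> h1"
proof -
  have below: "b t \<le> h1" if "t \<ge> 0" "a t \<le> \<beta>" for t
    by (rule stays_below_barrier[OF assms(1,2,4) _ that]) (rule barrier)
  define T where "T = max 0 (\<beta> + h1 - a 0 - b 0)"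
  have "a T \<ge> \<beta>"
  proof (rule ccontr)
    assume "\<not> a T \<ge> \<beta>"
    then have "b T \<le> h1" using below[of T] by (simp add: T_def)
    with \<open>\<not> a T \<ge> \<beta>\<close> show False using sum_eq[of T] assms by (simp add: T_def max_def split: if_splits)
  qed
  then obtain t where "0 \<le> t" "t \<le> T" "a t = \<beta>"
    using IVT'[of a 0 \<beta> T] a_continuous[of 0 T] assms(3) by (auto simp: T_def)
  then show ?thesis using below[of t] by auto
qed

lemma filterlim_a:
  assumes "\<And>K::real. \<exists>t\<ge>0. a t \<ge> K"
  shows "filterlim a at_top at_top"
  unfolding filterlim_at_top
proof
  fix K
  obtain s where s: "s \<ge> 0" "a s \<ge> K" using assms by blast
  show "\<forall>\<^sub>F t in at_top. a t \<ge> K"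
    using eventually_ge_at_top[of s] by eventually_elim (use s a_mono in force)
qed

text \<open>
  The hypotheses produce extreme ratios at points far out rather than at late times; by monotonicity, a
  curve can be far out only late.
\<close>

lemma ratio_oscillates:
  assumes low: "\<And>K::real. K > 0 \<Longrightarrow> \<exists>t\<ge>0. a t \<ge> K \<and> b t \<le> a t / K"
    and high: "\<And>K::real. K > 0 \<Longrightarrow> \<exists>t\<ge>0. b t \<ge> K \<and> a t \<le> b t / K"
  shows "Liminf at_top (\<lambda>t. ereal (b t / a t)) = 0" "Limsup at_top (\<lambda>t. ereal (b t / a t)) = \<infinity>"
proof -
  have "\<exists>t\<ge>0. a t \<ge> K" "\<exists>t\<ge>0. b t \<ge> K" for K
    using low[of "max K 1"] high[of "max K 1"] by (auto simp: less_max_iff_disj)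
  then have a_lim: "filterlim a at_top at_top" and b_lim: "filterlim b at_top at_top"
    using filterlim_a monotone_unit_curve.filterlim_a[OF swap] by auto
  then have pos: "\<forall>\<^sub>F t in at_top. a t > 0 \<and> b t > 0"
    by (auto simp: eventually_conj_iff filterlim_at_top_dense)
  show "Liminf at_top (\<lambda>t. ereal (b t / a t)) = 0"
  proof (rule antisym)
    show "0 \<le> Liminf at_top (\<lambda>t. ereal (b t / a t))"
      by (rule Liminf_bounded) (use pos in \<open>auto elim!: eventually_mono\<close>)
    show "Liminf at_top (\<lambda>t. ereal (b t / a t)) \<le> 0"
    proof (rule ccontr)
      assume "\<not> ?thesis"
      then obtain y where y: "0 < ereal y" "ereal y < Liminf at_top (\<lambda>t. ereal (b t / a t))"
        using ereal_dense2[of 0] by (auto simp: not_le)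
      then have "\<forall>\<^sub>F t in at_top. y < b t / a t" using less_LiminfD[OF y(2)] by simp
      then obtain T where T: "\<And>t. t \<ge> T \<Longrightarrow> y < b t / a t" unfolding eventually_at_top_linorder by auto
      define K where "K = max (1 / y) (max (a (max T 0) + 1) 1)"
      have K: "K \<ge> 1 / y" "K > a (max T 0)" "K \<ge> 1" by (auto simp: K_def)
      obtain t where t: "t \<ge> 0" "a t \<ge> K" "b t \<le> a t / K" using low[of K] K by auto
      have "t \<ge> T" using a_mono[of t "max T 0"] t K by (cases "t \<le> max T 0") auto
      from T[OF this] have "y < b t / a t" .
      also have "\<dots> \<le> 1 / K" using t K by (simp add: divide_simps mult_ac)
      also have "\<dots> \<le> y" using K y by (simp add: field_simps)
      finally show False by simp
    qed
  qed
  show "Limsup at_top (\<lambda>t. ereal (b t / a t)) = \<infinity>"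
  proof (rule ccontr)
    assume "\<not> ?thesis"
    then obtain y where y: "Limsup at_top (\<lambda>t. ereal (b t / a t)) < ereal y"
      using less_PInf_Ex_of_nat by (metis ereal_infty_less(1) less_ereal.simps(4) real_of_ereal.cases)
    then have "\<forall>\<^sub>F t in at_top. b t / a t < y" using Limsup_lessD[OF y] by simp
    with pos have "\<forall>\<^sub>F t in at_top. b t / a t < y \<and> a t > 0" by eventually_elim auto
    then obtain T where T: "\<And>t. t \<ge> T \<Longrightarrow> b t / a t < y \<and> a t > 0" unfolding eventually_at_top_linorder by auto
    define K where "K = max y (max (b (max T 0) + 1) 1)"
    have K: "K \<ge> y" "K > b (max T 0)" "K \<ge> 1" by (auto simp: K_def)
    obtain t where t: "t \<ge> 0" "b t \<ge> K" "a t \<le> b t / K" using high[of K] K by auto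
    have "t \<ge> T" using b_mono[of t "max T 0"] t K by (cases "t \<le> max T 0") auto
    from T[OF this] have "b t / a t < y" "a t > 0" by auto
    moreover have "K \<le> b t / a t" using t K \<open>a t > 0\<close> by (simp add: field_simps)
    ultimately show False using K by simp
  qed
qed

end

section \<open>Measurability in the space of continuous fields\<close>

interpretation fields: Metric_space cont_fields field_dist
  by (rule Metric_space_cont_fields)

lemma space_borel_fields: "space borel_fields = cont_fields"
  unfolding borel_fields_def by (simp add: space_measure_of_conv)

lemma sets_borel_fields:
  "sets borel_fields = sigma_sets cont_fields {U. openin fields.mtopology U}"
  unfolding borel_fields_def using openin_subset[of fields.mtopology]
  by (intro sets_measure_of) auto

lemma measurable_borel_fieldsI:
  assumes "\<And>\<omega>. \<omega> \<in> space M \<Longrightarrow> F \<omega> \<in> cont_fields"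
    and "\<And>U. openin fields.mtopology U \<Longrightarrow> F -` U \<inter> space M \<in> sets M"
  shows "F \<in> measurable M borel_fields"
  by (rule measurable_sigma_sets[OF sets_borel_fields])
     (use assms openin_subset[of fields.mtopology] in auto)

text \<open>
  The first \<open>N\<close> terms of the series only see the square of size \<open>N\<close>, and the remaining ones
  contribute at most \<open>(1/2)^N\<close>.
\<close>

lemma field_dist_le:
  assumes uw: "u \<in> cont_fields" "w \<in> cont_fields" and e: "\<And>x. x \<in> square N \<Longrightarrow> norm (u x - w x) \<le> e"
  shows "field_dist u w \<le> e + (1/2) ^ N"
proof -
  have s: "min (sup_dist (Suc n) u w) 1 \<le> e" if "n < N" for n
  proof -
    have "sup_dist (Suc n) u w \<le> e"
      unfolding sup_dist_def
    proof (rule cSUP_least)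
      show "square (Suc n) \<noteq> {}" using zero_in_square by blast
      show "norm (u x - w x) \<le> e" if "x \<in> square (Suc n)" for x
        using that \<open>n < N\<close> by (intro e) (auto simp: square_def)
    qed
    then show ?thesis by simp
  qed
  have e0: "e \<ge> 0" using order.trans[OF norm_ge_zero e[OF zero_in_square]] .
  note sm = field_dist_summable[OF uw]
  have g: "(\<lambda>n. (1/2::real) ^ Suc n) sums 1" using power_half_series .
  have "field_dist u w = (\<Sum>n. (1/2) ^ Suc (n + N) * min (sup_dist (Suc (n + N)) u w) 1)
      + (\<Sum>n<N. (1/2) ^ Suc n * min (sup_dist (Suc n) u w) 1)"
    using uw suminf_split_initial_segment[OF sm, of N] by (simp add: field_dist_def)
  also have "(\<Sum>n. (1/2) ^ Suc (n + N) * min (sup_dist (Suc (n + N)) u w) 1) \<le> (\<Sum>n. (1/2) ^ N * (1/2) ^ Suc n)"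
  proof (rule suminf_le)
    show "summable (\<lambda>n. (1/2) ^ Suc (n + N) * min (sup_dist (Suc (n + N)) u w) 1)"
      using summable_ignore_initial_segment[OF sm, of N] by simp
    show "summable (\<lambda>n. (1/2::real) ^ N * (1/2) ^ Suc n)" using g sums_summable summable_mult by blast
    show "(1/2) ^ Suc (n + N) * min (sup_dist (Suc (n + N)) u w) 1 \<le> (1/2) ^ N * (1/2) ^ Suc n" for n
      using mult_left_mono[of "min (sup_dist (Suc (n + N)) u w) 1" 1 "(1/2) ^ Suc (n + N)"]
      by (simp add: power_add mult_ac)
  qed
  also have "\<dots> = (1/2) ^ N" using suminf_mult[OF sums_summable[OF g], of "(1/2) ^ N"] sums_unique[OF g] by simp
  also have "(\<Sum>n<N. (1/2) ^ Suc n * min (sup_dist (Suc n) u w) 1) \<le> (\<Sum>n<N. (1/2) ^ Suc n * e)"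
    by (intro sum_mono mult_left_mono s) auto
  also have "\<dots> = (\<Sum>n<N. (1/2) ^ Suc n) * e" by (simp add: sum_distrib_right)
  also have "\<dots> \<le> 1 * e"
    using sum_le_suminf[OF sums_summable[OF g], of "{..<N}"] sums_unique[OF g] e0
    by (intro mult_right_mono) auto
  finally show ?thesis by simp
qed

lemma shift_in_cont_fields: "u \<in> cont_fields \<Longrightarrow> shift z u \<in> cont_fields"
  unfolding cont_fields_def shift_def
  by (auto intro!: continuous_on_compose2[of UNIV u] continuous_intros)

lemma norm_le_field_dist:
  assumes uw: "u \<in> cont_fields" "w \<in> cont_fields" and d: "field_dist u w < (1/2) ^ Suc n" and x: "x \<in> square (Suc n)"
  shows "norm (u x - w x) \<le> 2 ^ Suc n * field_dist u w"
proof -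
  have "(1/2) ^ Suc n * min (sup_dist (Suc n) u w) 1 \<le> field_dist u w"
    using uw sum_le_suminf[OF field_dist_summable[OF uw], of "{n}"] sup_dist_nonneg[OF uw]
    by (simp add: field_dist_def)
  then have "min (sup_dist (Suc n) u w) 1 \<le> 2 ^ Suc n * field_dist u w"
    by (simp add: field_simps)
  moreover have "2 ^ Suc n * field_dist u w < 1" using d by (simp add: field_simps)
  ultimately show ?thesis using le_sup_dist[OF uw x] by linarith
qed

text \<open>
  Shifts are continuous for the metric: the square of size \<open>N\<close> is moved into a square whose size
  exceeds \<open>N\<close> by a bound on the shift, so a ball around \<open>u\<close> of small radius is mapped into a given
  ball around the shifted field.
\<close>

lemma shift_measurable: "shift z \<in> measurable borel_fields borel_fields"
proof (rule measurable_borel_fieldsI)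
  show "shift z u \<in> cont_fields" if "u \<in> space borel_fields" for u
    using that shift_in_cont_fields by (simp add: space_borel_fields)
  fix U assume U: "openin fields.mtopology U"
  have "openin fields.mtopology (shift z -` U \<inter> cont_fields)"
    unfolding fields.openin_mtopology
  proof (intro conjI allI impI)
    fix u assume u: "u \<in> shift z -` U \<inter> cont_fields"
    then obtain r where r: "r > 0" "fields.mball (shift z u) r \<subseteq> U"
      using U unfolding fields.openin_mtopology by blast
    obtain N where N: "(1/2::real) ^ N < r / 2" using real_arch_pow_inv[of "r/2" "1/2"] r by auto
    obtain k where k: "\<bar>z$1\<bar> \<le> real k" "\<bar>z$2\<bar> \<le> real k"
      using real_arch_simple[of "max \<bar>z$1\<bar> \<bar>z$2\<bar>"] by auto
    define n where "n = N + k"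
    define \<delta> where "\<delta> = min ((1/2) ^ Suc n) (r / 2 / 2 ^ Suc n)"
    have \<delta>: "\<delta> > 0" using r by (simp add: \<delta>_def)
    have "fields.mball u \<delta> \<subseteq> shift z -` U \<inter> cont_fields"
    proof
      fix w assume "w \<in> fields.mball u \<delta>"
      then have w: "u \<in> cont_fields" "w \<in> cont_fields" "field_dist u w < \<delta>" by auto
      have "field_dist (shift z u) (shift z w) \<le> 2 ^ Suc n * field_dist u w + (1/2) ^ N"
      proof (rule field_dist_le)
        fix x assume "x \<in> square N"
        then have "x + z \<in> square (Suc n)" using k by (auto simp: square_def n_def)
        then show "norm (shift z u x - shift z w x) \<le> 2 ^ Suc n * field_dist u w"
          unfolding shift_def using w by (intro norm_le_field_dist) (auto simp: \<delta>_def)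
      qed (use w shift_in_cont_fields in auto)
      also have "2 ^ Suc n * field_dist u w < r / 2"
        using w(3) by (simp add: \<delta>_def field_simps)
      finally have "field_dist (shift z u) (shift z w) < r" using N by simp
      then show "w \<in> shift z -` U \<inter> cont_fields"
        using r w shift_in_cont_fields by auto
    qed
    then show "\<exists>r>0. fields.mball u r \<subseteq> shift z -` U \<inter> cont_fields" using \<delta> by blast
  qed auto
  then show "shift z -` U \<inter> space borel_fields \<in> sets borel_fields"
    by (auto simp: space_borel_fields sets_borel_fields)
qed

definition rational_points :: "(real^2) set" where
  "rational_points = {x. \<forall>i. x $ i \<in> \<rat>}"

lemma countable_rational_points: "countable rational_points"
proof (rule countable_subset)
  show "rational_points \<subseteq> (\<lambda>(a, b). vector [a, b]) ` (\<rat> \<times> \<rat>)"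
  proof
    fix x :: "real^2" assume "x \<in> rational_points"
    then have "x $ 1 \<in> \<rat>" "x $ 2 \<in> \<rat>" "x = vector [x $ 1, x $ 2]"
      by (auto simp: rational_points_def vec_eq_iff forall_2)
    then show "x \<in> (\<lambda>(a, b). vector [a, b]) ` (\<rat> \<times> \<rat>)" by (metis (mono_tags) SigmaI image_eqI case_prod_conv)
  qed
qed (intro countable_image countable_SIGMA countable_rat)

lemma rational_point_near:
  fixes x :: "real^2"
  assumes "e > 0"
  obtains q where "q \<in> rational_points" "norm (x - q) < e"
proof -
  have "\<exists>r. r \<in> \<rat> \<and> \<bar>x $ i - r\<bar> < e / 2" for i
  proof -
    obtain r where "r \<in> \<rat>" "x $ i - e/2 < r" "r < x $ i + e/2"
      using Rats_dense_in_real[of "x $ i - e/2" "x $ i + e/2"] assms by auto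
    then show ?thesis by (intro exI[of _ r]) (auto simp: abs_if)
  qed
  then obtain f where f: "\<And>i. f i \<in> \<rat>" "\<And>i. \<bar>x $ i - f i\<bar> < e / 2" by metis
  have "norm (x - (\<chi> i. f i)) \<le> (\<Sum>i\<in>UNIV. \<bar>(x - (\<chi> i. f i)) $ i\<bar>)" by (rule norm_le_l1_cart)
  also have "\<dots> < e" using f(2)[of 1] f(2)[of 2] by (simp add: sum_2)
  finally show ?thesis using f(1) by (intro that[of "\<chi> i. f i"]) (auto simp: rational_points_def)
qed

text \<open>
  Under a common Lipschitz bound, the values of a field on a finite net control the field on a square. Every
  preimage of an open set is then a countable union of events that restrict finitely many evaluations
  at rational points to within a rational distance of rational values.
\<close>

lemma Lipschitz_field_measurable:
  fixes F :: "'a \<Rightarrow> vector_field"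
  assumes eval: "\<And>x. (\<lambda>\<omega>. F \<omega> x) \<in> borel_measurable M"
    and L: "L \<ge> 0" "\<And>\<omega> x y. \<omega> \<in> space M \<Longrightarrow> norm (F \<omega> x - F \<omega> y) \<le> L * norm (x - y)"
  shows "F \<in> measurable M borel_fields"
proof (rule measurable_borel_fieldsI)
  show F: "F \<omega> \<in> cont_fields" if "\<omega> \<in> space M" for \<omega>
    unfolding cont_fields_def mem_Collect_eq
    by (rule lipschitz_on_continuous_on[of L]) (use L(1) L(2)[OF that] in \<open>auto simp: lipschitz_on_def dist_norm\<close>)
  fix U assume U: "openin fields.mtopology U"
  \<comment> \<open>A cylinder: a finite set of rational points, prescribed rational values there, and a tolerance.\<close>
  define cyl where "cyl = (\<lambda>(A, q, e). {\<omega> \<in> space M. \<forall>x\<in>A. norm (F \<omega> x - q x) < e})"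
  define I where "I = (SIGMA A:{A. finite A \<and> A \<subseteq> rational_points}. (A \<rightarrow>\<^sub>E rational_points) \<times> (\<rat>::real set))"
  have "countable I"
    unfolding I_def
    by (intro countable_SIGMA countable_rat countable_Collect_finite_subset countable_rational_points countable_PiE) auto
  have cyl_sets: "cyl i \<in> sets M" if "i \<in> I" for i
  proof -
    obtain A q e where i: "i = (A, q, e)" by (cases i)
    have A: "finite A" using that by (simp add: I_def i)
    note eval[measurable]
    have "{\<omega> \<in> space M. \<forall>x\<in>A. norm (F \<omega> x - q x) < e} \<in> sets M"
      by (intro sets.sets_Collect_finite_All A) measurable
    then show ?thesis by (simp add: cyl_def i)
  qed
  have "\<exists>i\<in>I. \<omega> \<in> cyl i \<and> cyl i \<subseteq> F -` U" if \<omega>: "\<omega> \<in> space M" "F \<omega> \<in> U" for \<omega>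
  proof -
    obtain r where r: "r > 0" "fields.mball (F \<omega>) r \<subseteq> U"
      using U \<omega> unfolding fields.openin_mtopology by blast
    obtain N where N: "(1/2::real) ^ N < r / 2" using real_arch_pow_inv[of "r/2" "1/2"] r by auto
    \<comment> \<open>Two fields of one cylinder differ by at most \<open>2 e\<close> on the net, and by \<open>2 L e\<close> more between its points.\<close>
    obtain e where e: "e \<in> \<rat>" "0 < e" "e < r / (4 + 4 * L)"
      using Rats_dense_in_real[of 0 "r / (4 + 4 * L)"] r L(1) by auto
    have "square N \<subseteq> (\<Union>q\<in>rational_points. ball q e)"
    proof
      fix x obtain q where "q \<in> rational_points" "norm (x - q) < e" using rational_point_near[OF e(2)] .
      then show "x \<in> (\<Union>q\<in>rational_points. ball q e)" by (auto simp: dist_norm norm_minus_commute)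
    qed
    then obtain A where A: "A \<subseteq> rational_points" "finite A" "square N \<subseteq> (\<Union>q\<in>A. ball q e)"
      using compactE_image[OF compact_square, of rational_points "\<lambda>q. ball q e"] by auto
    have "\<exists>q. q \<in> rational_points \<and> norm (F \<omega> x - q) < e" for x
      using rational_point_near[OF e(2), of "F \<omega> x"] by metis
    then obtain q where q: "\<And>x. q x \<in> rational_points" "\<And>x. norm (F \<omega> x - q x) < e" by metis
    define i where "i = (A, restrict q A, e)"
    have "i \<in> I" using A q e by (auto simp: I_def i_def)
    moreover have "\<omega> \<in> cyl i" using q \<omega> by (auto simp: cyl_def i_def)
    moreover have "cyl i \<subseteq> F -` U"
    proof
      fix \<omega>' assume "\<omega>' \<in> cyl i"
      then have \<omega>': "\<omega>' \<in> space M" "\<And>x. x \<in> A \<Longrightarrow> norm (F \<omega>' x - q x) < e"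
        by (auto simp: cyl_def i_def)
      have "field_dist (F \<omega>) (F \<omega>') \<le> e * (2 + 2 * L) + (1/2) ^ N"
      proof (rule field_dist_le[OF F F])
        fix x assume "x \<in> square N"
        then obtain p where p: "p \<in> A" "norm (x - p) < e" using A(3) by (auto simp: dist_norm norm_minus_commute)
        have "norm (F \<omega> x - F \<omega>' x) \<le> norm (F \<omega> x - F \<omega> p) + norm (F \<omega> p - q p) + norm (F \<omega>' p - q p) + norm (F \<omega>' x - F \<omega>' p)"
          by norm
        also have "\<dots> \<le> L * e + e + e + L * e"
          using L(2)[OF \<omega>(1), of x p] L(2)[OF \<omega>'(1), of x p] q(2)[of p] \<omega>'(2)[OF p(1)]
            mult_left_mono[OF less_imp_le[OF p(2)] L(1)] by linarith
        finally show "norm (F \<omega> x - F \<omega>' x) \<le> e * (2 + 2 * L)" by (simp add: algebra_simps)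
      qed (use \<omega> \<omega>' in auto)
      also have "e * (2 + 2 * L) < r / 2" using e(3) L(1) by (simp add: field_simps)
      finally have "field_dist (F \<omega>) (F \<omega>') < r" using N by simp
      then show "\<omega>' \<in> F -` U" using r F \<omega> \<omega>' by auto
    qed
    ultimately show ?thesis by blast
  qed
  moreover have "cyl i \<subseteq> space M" for i by (auto simp: cyl_def split: prod.splits)
  ultimately have "F -` U \<inter> space M = (\<Union>i\<in>{i\<in>I. cyl i \<subseteq> F -` U}. cyl i)"
    by blast
  also have "\<dots> \<in> sets M"
    using \<open>countable I\<close> cyl_sets by (intro sets.countable_UN'') auto
  finally show "F -` U \<inter> space M \<in> sets M" .
qed

section \<open>The Poisson process\<close>

definition void :: "'a set \<Rightarrow> 'a set set" where
  "void A = {Z. Z \<inter> A = {}}"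

text \<open>
  A point configuration is recorded as the plain set of its points. Only hitting or missing a
  set is observed, which is all that the incidence of barriers depends on.
\<close>

definition configurations :: "'a::euclidean_space set measure" where
  "configurations = sigma UNIV (void ` {A. A \<in> sets borel \<and> bounded A})"

lemma space_configurations [simp]: "space configurations = UNIV"
  unfolding configurations_def by (simp add: space_measure_of_conv)

lemma sets_configurations:
  "sets configurations = sigma_sets UNIV (void ` {A. A \<in> sets borel \<and> bounded A})"
  unfolding configurations_def by (intro sets_measure_of) auto

lemma void_Un: "void A \<inter> void B = void (A \<union> B)"
  by (auto simp: void_def)

lemma Int_stable_void: "Int_stable (void ` {A. A \<in> sets borel \<and> bounded A})"
  by (auto simp: Int_stable_def void_Un)

lemma void_in_sets_bounded: "A \<in> sets borel \<Longrightarrow> bounded A \<Longrightarrow> void A \<in> sets configurations"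
  unfolding sets_configurations by auto

lemma void_in_sets [measurable]: "A \<in> sets borel \<Longrightarrow> void A \<in> sets configurations" for A :: "'a::euclidean_space set"
proof -
  assume A: "A \<in> sets borel"
  have "x \<notin> Z" if "\<forall>n. Z \<inter> (A \<inter> cball 0 (real n)) = {}" "x \<in> A" for x :: 'a and Z
  proof -
    obtain n where "norm x \<le> real n" using real_arch_simple by blast
    then have "x \<in> A \<inter> cball 0 (real n)" using that(2) by simp
    then show ?thesis using that(1) by blast
  qed
  then have "void A = (\<Inter>n. void (A \<inter> cball 0 (real n)))"
    unfolding void_def by blast
  also have "\<dots> \<in> sets configurations"
    using A sets.top[of "configurations :: 'a set measure"]
    by (intro sets.countable_INT'' void_in_sets_bounded) auto
  finally show "void A \<in> sets configurations" .
qed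

text \<open>
  The shells partition the space into countably many pieces of finite positive volume, finitely
  many of which cover a bounded set, so every void probability is a finite product.
\<close>

definition shell :: "nat \<Rightarrow> 'a::euclidean_space set" where
  "shell k = {x. real k \<le> norm x \<and> norm x < real k + 1}"

lemma shell_borel [measurable]: "shell k \<in> sets borel"
  unfolding shell_def by measurable

lemma bounded_shell: "bounded (shell k)"
  unfolding bounded_iff shell_def by (intro exI[of _ "real k + 1"]) auto

lemma shell_inject: "x \<in> shell j \<Longrightarrow> x \<in> shell k \<Longrightarrow> j = k"
  unfolding shell_def by simp

lemma disjoint_shell: "disjoint_family_on shell K"
  unfolding disjoint_family_on_def using shell_inject by blast

lemma bounded_subset_shells:
  assumes "bounded A"
  obtains N where "A \<subseteq> (\<Union>k<N. shell k)"
proof -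
  obtain b where b: "\<And>x. x \<in> A \<Longrightarrow> norm x \<le> b" using assms by (auto simp: bounded_iff)
  have "A \<subseteq> (\<Union>k<Suc (nat \<lfloor>b\<rfloor>). shell k)"
  proof
    fix x assume "x \<in> A"
    then have "nat \<lfloor>norm x\<rfloor> < Suc (nat \<lfloor>b\<rfloor>)" using b[of x] by (simp add: less_Suc_eq_le nat_mono floor_mono)
    moreover have "x \<in> shell (nat \<lfloor>norm x\<rfloor>)"
      by (auto simp: shell_def)
    ultimately show "x \<in> (\<Union>k<Suc (nat \<lfloor>b\<rfloor>). shell k)" by blast
  qed
  with that show ?thesis by blast
qed

definition shell_vol :: "'a::euclidean_space itself \<Rightarrow> nat \<Rightarrow> real" where
  "shell_vol T k = measure lborel (shell k :: 'a set)"

lemma emeasure_shell: "emeasure lborel (shell k :: 'a::euclidean_space set) = ennreal (shell_vol TYPE('a) k)"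
  unfolding shell_vol_def using emeasure_bounded_finite[OF bounded_shell]
  by (intro emeasure_eq_ennreal_measure) (auto simp: less_top)

lemma shell_vol_pos: "0 < shell_vol TYPE('a::euclidean_space) k"
proof -
  obtain b :: 'a where b: "b \<in> Basis" using nonempty_Basis by blast
  have "ball ((real k + 1/2) *\<^sub>R b) (1/2) \<subseteq> shell k"
  proof
    fix x assume "x \<in> ball ((real k + 1/2) *\<^sub>R b) (1/2)"
    then have d: "norm (x - (real k + 1/2) *\<^sub>R b) < 1/2" by (simp add: dist_norm norm_minus_commute)
    have n: "norm ((real k + 1/2) *\<^sub>R b) = real k + 1/2" using b by simp
    show "x \<in> shell k"
      using norm_triangle_ineq2[of x "(real k + 1/2) *\<^sub>R b"]
        norm_triangle_ineq2[of "(real k + 1/2) *\<^sub>R b" x] d n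
      by (simp add: shell_def norm_minus_commute)
  qed
  then have "emeasure lborel (ball ((real k + 1/2) *\<^sub>R b) (1/2)) \<le> emeasure lborel (shell k :: 'a set)"
    by (intro emeasure_mono) auto
  moreover have "emeasure lborel (ball ((real k + 1/2) *\<^sub>R b) (1/2)) > 0"
    by (simp add: emeasure_ball)
  ultimately show ?thesis by (auto simp: emeasure_shell simp flip: ennreal_less_zero_iff)
qed

definition shell_law :: "'a::euclidean_space itself \<Rightarrow> nat \<Rightarrow> (nat \<times> (nat \<Rightarrow> 'a)) measure" where
  "shell_law T k = measure_pmf (poisson_pmf (shell_vol T k)) \<Otimes>\<^sub>M (\<Pi>\<^sub>M i\<in>UNIV. uniform_measure lborel (shell k))"

text \<open>
  In the shell \<open>k\<close>, the first component of \<open>\<omega> k\<close> is the number of points and the second one an infinite supply of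
  positions. Positions outside the shell, which have probability \<open>0\<close>, are discarded, so that the points of a
  bounded set depend on finitely many shells for every \<open>\<omega>\<close>.
\<close>

definition points :: "(nat \<Rightarrow> nat \<times> (nat \<Rightarrow> 'a)) \<Rightarrow> 'a::euclidean_space set" where
  "points \<omega> = {snd (\<omega> k) i | k i. i < fst (\<omega> k) \<and> snd (\<omega> k) i \<in> shell k}"

definition poisson_process :: "'a::euclidean_space set measure" where
  "poisson_process = distr (\<Pi>\<^sub>M k\<in>UNIV. shell_law TYPE('a) k) configurations points"

lemma prob_space_uniform_shell: "prob_space (uniform_measure lborel (shell k :: 'a::euclidean_space set))"
  using shell_vol_pos[where 'a = 'a, of k] by (intro prob_space_uniform_measure) (auto simp: emeasure_shell)

lemma prob_space_shell_law: "prob_space (shell_law TYPE('a::euclidean_space) k)"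
proof -
  interpret U: product_prob_space "\<lambda>_::nat. uniform_measure lborel (shell k :: 'a set)" UNIV
    by (intro product_prob_spaceI prob_space_uniform_shell)
  interpret pair_prob_space "measure_pmf (poisson_pmf (shell_vol TYPE('a) k))" "\<Pi>\<^sub>M i\<in>(UNIV::nat set). uniform_measure lborel (shell k :: 'a set)"
    ..
  show ?thesis unfolding shell_law_def by (rule prob_space_axioms)
qed

lemma shell_law_void_sets:
  assumes [measurable]: "A \<in> sets borel"
  shows "{x. \<forall>i<fst x. snd x i \<notin> A \<inter> shell k} \<in> sets (shell_law TYPE('a::euclidean_space) k)"
proof -
  have "{x \<in> space (shell_law TYPE('a) k). \<forall>i<fst x. snd x i \<notin> A \<inter> shell k} \<in> sets (shell_law TYPE('a) k)"
    unfolding shell_law_def by measurable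
  then show ?thesis by (simp add: shell_law_def space_pair_measure space_PiM)
qed

text \<open>
  With \<open>V\<close> the volume of the shell and \<open>q\<close> the probability that a uniform point of the shell misses
  \<open>A\<close>, conditioning on the number of points gives the exponential series
  \<open>\<Sum>m. V^m / m! exp(-V) q^m = exp(-V (1 - q))\<close>.
\<close>

lemma emeasure_shell_law_void:
  fixes A :: "'a::euclidean_space set"
  assumes A [measurable]: "A \<in> sets borel"
  shows "emeasure (shell_law TYPE('a) k) {x. \<forall>i<fst x. snd x i \<notin> A \<inter> shell k}
    = ennreal (exp (- measure lborel (A \<inter> shell k)))"
proof -
  let ?U = "uniform_measure lborel (shell k :: 'a set)"
  let ?P = "\<Pi>\<^sub>M i\<in>(UNIV::nat set). ?U"
  define V where "V = shell_vol TYPE('a) k"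
  define q where "q = 1 - measure lborel (A \<inter> shell k) / V"
  have V: "V > 0" unfolding V_def by (rule shell_vol_pos)
  have le: "measure lborel (A \<inter> shell k) \<le> V"
    unfolding V_def shell_vol_def by (rule measure_mono_fmeasurable) (auto simp: fmeasurable_def emeasure_shell)
  then have q: "q \<ge> 0" using V by (simp add: q_def)
  interpret U: product_prob_space "\<lambda>_::nat. ?U" UNIV
    by (intro product_prob_spaceI prob_space_uniform_shell)
  have U_out: "emeasure ?U (UNIV - (A \<inter> shell k)) = ennreal q"
  proof -
    note U = prob_space_uniform_shell[of k, where 'a = 'a]
    have "emeasure ?U (A \<inter> shell k) = emeasure lborel (A \<inter> shell k) / emeasure lborel (shell k :: 'a set)"
      by (subst emeasure_uniform_measure) (auto simp: Int_absorb1)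
    also have "emeasure lborel (A \<inter> shell k) = ennreal (measure lborel (A \<inter> shell k))"
      using emeasure_bounded_finite[OF bounded_subset[OF bounded_shell[of k], of "A \<inter> shell k"]]
      by (intro emeasure_eq_ennreal_measure) (auto simp: less_top)
    finally have "emeasure ?U (A \<inter> shell k) = ennreal (measure lborel (A \<inter> shell k) / V)"
      using V by (simp add: emeasure_shell V_def[symmetric] divide_ennreal del: emeasure_uniform_measure)
    then have "measure ?U (A \<inter> shell k) = measure lborel (A \<inter> shell k) / V"
      using V measure_eq_emeasure_eq_ennreal[of "measure lborel (A \<inter> shell k) / V" ?U "A \<inter> shell k"] by (simp del: emeasure_uniform_measure)
    then have "measure ?U (space ?U - (A \<inter> shell k)) = q"
      by (subst prob_space.prob_compl[OF U]) (auto simp: q_def)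
    then show ?thesis by (simp add: finite_measure.emeasure_eq_measure[OF prob_space.finite_measure[OF U]] del: emeasure_uniform_measure)
  qed
  have sect: "emeasure ?P {f. \<forall>i<m. f i \<notin> A \<inter> shell k} = ennreal (q ^ m)" for m
  proof -
    have "{f. \<forall>i<m. f i \<notin> A \<inter> shell k} = prod_emb UNIV (\<lambda>_. ?U) {..<m} (\<Pi>\<^sub>E i\<in>{..<m}. UNIV - (A \<inter> shell k))"
      by (rule set_eqI) (simp add: prod_emb_iff restrict_PiE_iff Pi_iff Ball_def)
    also have "emeasure ?P \<dots> = (\<Prod>i<m. emeasure ?U (UNIV - (A \<inter> shell k)))"
      by (rule U.emeasure_PiM_emb) (use sets.compl_sets[of "A \<inter> shell k" borel] in auto)
    also have "\<dots> = ennreal (q ^ m)"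
      unfolding U_out using q by (simp add: ennreal_power)
    finally show ?thesis .
  qed
  have "emeasure (shell_law TYPE('a) k) {x. \<forall>i<fst x. snd x i \<notin> A \<inter> shell k}
      = (\<integral>\<^sup>+ m. emeasure ?P (Pair m -` {x. \<forall>i<fst x. snd x i \<notin> A \<inter> shell k}) \<partial>measure_pmf (poisson_pmf V))"
    using shell_law_void_sets[OF A, of k] unfolding shell_law_def V_def
    by (rule U.P.emeasure_pair_measure_alt)
  also have "\<dots> = (\<integral>\<^sup>+ m. ennreal (q ^ m) \<partial>measure_pmf (poisson_pmf V))"
    unfolding vimage_def by (simp only: mem_Collect_eq fst_conv snd_conv sect)
  also have "\<dots> = (\<Sum>m. ennreal (V ^ m / fact m * exp (- V) * q ^ m))"
    by (simp add: nn_integral_measure_pmf nn_integral_count_space_nat V q less_imp_le[OF V] flip: ennreal_mult)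
  also have "\<dots> = ennreal (exp (- V) * exp (V * q))"
  proof (rule suminf_ennreal_eq)
    have "(\<lambda>m. exp (- V) * ((V * q) ^ m /\<^sub>R fact m)) sums (exp (- V) * exp (V * q))"
      by (intro sums_mult exp_converges)
    then show "(\<lambda>m. V ^ m / fact m * exp (- V) * q ^ m) sums (exp (- V) * exp (V * q))"
      by (simp add: power_mult_distrib divide_inverse mult_ac)
  qed (use V q in auto)
  also have "exp (- V) * exp (V * q) = exp (- measure lborel (A \<inter> shell k))"
    using V by (simp add: q_def algebra_simps flip: exp_add)
  finally show ?thesis .
qed

lemma points_void:
  assumes "A \<subseteq> (\<Union>k<N. shell k)"
  shows "points \<omega> \<in> void A \<longleftrightarrow> (\<forall>k<N. \<forall>i<fst (\<omega> k). snd (\<omega> k) i \<notin> A \<inter> shell k)"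
proof -
  have "k < N" if "x \<in> A" "x \<in> shell k" for x k
    using assms that shell_inject by blast
  then show ?thesis unfolding void_def points_def by blast
qed

lemma points_vimage_void:
  assumes "A \<subseteq> (\<Union>k<N. shell k)"
  shows "points -` void A = prod_emb UNIV (shell_law TYPE('a::euclidean_space)) {..<N}
    (\<Pi>\<^sub>E k\<in>{..<N}. {x. \<forall>i<fst x. snd x i \<notin> A \<inter> shell k})"
  using points_void[OF assms]
  by (auto simp: prod_emb_def PiE_iff shell_law_def space_pair_measure space_PiM)

lemma points_measurable: "points \<in> measurable (\<Pi>\<^sub>M k\<in>UNIV. shell_law TYPE('a::euclidean_space) k) configurations"
proof (rule measurable_sigma_sets[OF sets_configurations])
  fix V :: "'a set set" assume "V \<in> void ` {A. A \<in> sets borel \<and> bounded A}"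
  then obtain A :: "'a set" where A: "V = void A" "A \<in> sets borel" "bounded A" by auto
  obtain N where N: "A \<subseteq> (\<Union>k<N. shell k)" using bounded_subset_shells[OF A(3)] .
  show "points -` V \<inter> space (\<Pi>\<^sub>M k\<in>UNIV. shell_law TYPE('a) k) \<in> sets (\<Pi>\<^sub>M k\<in>UNIV. shell_law TYPE('a) k)"
    unfolding A(1) points_vimage_void[OF N]
    by (intro sets.Int sets.top sets_PiM_I) (use shell_law_void_sets[OF A(2)] in auto)
qed auto

lemma sets_poisson_process [measurable_cong, simp]: "sets poisson_process = sets configurations"
  unfolding poisson_process_def by simp

lemma measurable_poisson_process: "measurable poisson_process N = measurable configurations N"
  by (rule measurable_cong_sets) auto

lemma space_poisson_process [simp]: "space poisson_process = UNIV"
  unfolding poisson_process_def by simp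

lemma prob_space_poisson_process: "prob_space (poisson_process :: 'a::euclidean_space set measure)"
  unfolding poisson_process_def
  by (intro prob_space.prob_space_distr prob_space_PiM prob_space_shell_law points_measurable)

lemma emeasure_poisson_void:
  fixes A :: "'a::euclidean_space set"
  assumes A: "A \<in> sets borel" "bounded A"
  shows "emeasure poisson_process (void A) = ennreal (exp (- measure lborel A))"
proof -
  obtain N where N: "A \<subseteq> (\<Union>k<N. shell k)" using bounded_subset_shells[OF A(2)] .
  interpret product_prob_space "shell_law TYPE('a)" UNIV
    by (intro product_prob_spaceI prob_space_shell_law)
  have "emeasure poisson_process (void A)
      = emeasure (\<Pi>\<^sub>M k\<in>UNIV. shell_law TYPE('a) k) (points -` void A)"
    unfolding poisson_process_def
    by (subst emeasure_distr[OF points_measurable])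
       (auto intro: void_in_sets A simp: space_PiM shell_law_def space_pair_measure)
  also have "\<dots> = (\<Prod>k<N. emeasure (shell_law TYPE('a) k) {x. \<forall>i<fst x. snd x i \<notin> A \<inter> shell k})"
    unfolding points_vimage_void[OF N]
    by (rule emeasure_PiM_emb) (use shell_law_void_sets[OF A(1)] in auto)
  also have "\<dots> = ennreal (\<Prod>k<N. exp (- measure lborel (A \<inter> shell k)))"
    by (simp only: emeasure_shell_law_void[OF A(1)] prod_ennreal exp_ge_zero)
  also have "(\<Prod>k<N. exp (- measure lborel (A \<inter> shell k))) = exp (- (\<Sum>k<N. measure lborel (A \<inter> shell k)))"
    by (simp add: exp_sum sum_negf[symmetric])
  also have "(\<Sum>k<N. measure lborel (A \<inter> shell k)) = measure lborel (\<Union>k<N. A \<inter> shell k)"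
  proof (rule measure_finite_Union[symmetric])
    show "disjoint_family_on (\<lambda>k. A \<inter> shell k) {..<N}"
      using disjoint_shell[of "{..<N}"] unfolding disjoint_family_on_def by blast
    show "emeasure lborel (A \<inter> shell k) \<noteq> \<infinity>" for k
      using emeasure_bounded_finite[OF bounded_subset[OF A(2), of "A \<inter> shell k"]] by auto
  qed (use A in auto)
  also have "(\<Union>k<N. A \<inter> shell k) = A" using N by auto
  finally show ?thesis .
qed

lemma measure_poisson_void:
  fixes A :: "'a::euclidean_space set"
  assumes "A \<in> sets borel" "bounded A"
  shows "measure poisson_process (void A) = exp (- measure lborel A)"
  using emeasure_poisson_void[OF assms] by (simp add: measure_def)

definition translate :: "'a::euclidean_space \<Rightarrow> 'a set \<Rightarrow> 'a set" where
  "translate a Z = (\<lambda>x. x - a) ` Z"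

lemma translate_vimage_void: "translate a -` void A = void ((\<lambda>x. x + a) ` A)"
  by (auto simp: translate_def void_def disjoint_iff image_iff algebra_simps)

lemma translation_borel:
  fixes A :: "'a::euclidean_space set"
  assumes "A \<in> sets borel"
  shows "(\<lambda>x. x + a) ` A \<in> sets borel"
proof -
  have "(\<lambda>x. x + a) ` A = (\<lambda>x. x - a) -` A \<inter> space borel"
    by (force simp: image_iff)
  also have "\<dots> \<in> sets borel" using assms by (intro measurable_sets[of _ borel borel]) auto
  finally show ?thesis .
qed

lemma translate_measurable [measurable]: "translate a \<in> measurable configurations configurations"
proof (rule measurable_sigma_sets[OF sets_configurations])
  fix V :: "'a set set" assume "V \<in> void ` {A. A \<in> sets borel \<and> bounded A}"
  then show "translate a -` V \<inter> space configurations \<in> sets configurations"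
    using void_in_sets[OF translation_borel] by (auto simp: translate_vimage_void)
qed auto

lemma measure_lborel_translation:
  fixes A :: "'a::euclidean_space set"
  assumes "A \<in> sets borel"
  shows "measure lborel ((\<lambda>x. x + a) ` A) = measure lborel A"
  using measure_translation[of a A] assms translation_borel[OF assms, of a]
  by (simp add: add.commute measure_completion)

text \<open>
  Void events form a \<open>\<pi>\<close>-system, so it is enough that void probabilities only depend on the volume.
\<close>

lemma poisson_process_translate:
  "distr poisson_process configurations (translate a) = (poisson_process :: 'a::euclidean_space set measure)"
proof (rule measure_eqI_generator_eq)
  show "Int_stable (void ` {A::'a set. A \<in> sets borel \<and> bounded A})" by (rule Int_stable_void)
  fix V :: "'a set set" assume "V \<in> void ` {A. A \<in> sets borel \<and> bounded A}"
  then obtain A :: "'a set" where A: "V = void A" "A \<in> sets borel" "bounded A" by auto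
  have b: "bounded ((\<lambda>x. x + a) ` A)"
    using bounded_translation[OF A(3), of a] by (simp add: add.commute)
  have m: "translate a \<in> measurable poisson_process configurations"
    by (simp add: measurable_poisson_process translate_measurable)
  show "emeasure (distr poisson_process configurations (translate a)) V = emeasure poisson_process V"
    unfolding A(1)
    by (subst emeasure_distr[OF m])
       (simp_all add: void_in_sets A translate_vimage_void emeasure_poisson_void translation_borel b measure_lborel_translation)
next
  show "range (\<lambda>_::nat. void ({} :: 'a set)) \<subseteq> void ` {A. A \<in> sets borel \<and> bounded A}" by auto
  show "emeasure (distr poisson_process configurations (translate a)) (void ({}::'a set)) \<noteq> \<infinity>"
  proof -
    interpret prob_space "distr poisson_process configurations (translate a :: 'a set \<Rightarrow> 'a set)"
      by (intro prob_space.prob_space_distr prob_space_poisson_process)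
         (simp add: measurable_poisson_process translate_measurable)
    show ?thesis by simp
  qed
qed (auto simp: sets_configurations void_def)

text \<open>
  First moment bound in the form \<open>1 - exp(-x) \<le> x\<close>.
\<close>

lemma poisson_hit:
  fixes A :: "'a::euclidean_space set"
  assumes "A \<in> sets borel" "bounded A"
  shows "measure poisson_process (- void A) \<le> measure lborel A"
proof -
  interpret prob_space "poisson_process :: 'a set measure" by (rule prob_space_poisson_process)
  have "prob (- void A) = 1 - exp (- measure lborel A)"
    using prob_compl[of "void A"] assms void_in_sets[of A]
    by (simp add: measure_poisson_void Compl_eq_Diff_UNIV)
  then show ?thesis using exp_ge_add_one_self[of "- measure lborel A"] by simp
qed

text \<open>
  An open \<open>W\<close> is a countable union of products \<open>U \<times> V\<close> of basic open sets, and the event of having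
  a point in \<open>V\<close> is the complement of a void event.
\<close>

lemma exists_point_measurable:
  fixes W :: "('b::second_countable_topology \<times> 'a::euclidean_space) set"
  assumes "open W"
  shows "{(Z, x). \<exists>e\<in>Z. (x, e) \<in> W} \<in> sets (configurations \<Otimes>\<^sub>M borel)"
proof -
  obtain B1 :: "'b set set" where B1: "countable B1" "topological_basis B1" using ex_countable_basis by blast
  obtain B2 :: "'a set set" where B2: "countable B2" "topological_basis B2" using ex_countable_basis by blast
  define I where "I = {(U, V). U \<in> B1 \<and> V \<in> B2 \<and> U \<times> V \<subseteq> W}"
  have "countable I"
    by (rule countable_subset[of _ "B1 \<times> B2"]) (use B1 B2 in \<open>auto simp: I_def\<close>)
  have "\<exists>(U, V)\<in>I. x \<in> U \<and> e \<in> V" if xe: "(x, e) \<in> W" for x e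
  proof -
    obtain U V where "open U" "open V" "(x, e) \<in> U \<times> V" "U \<times> V \<subseteq> W"
      by (rule open_prod_elim[OF assms xe])
    then have "open U" "open V" "x \<in> U" "e \<in> V" "U \<times> V \<subseteq> W" by auto
    moreover from this obtain U' where "U' \<in> B1" "x \<in> U'" "U' \<subseteq> U"
      using topological_basisE[OF B1(2)] by metis
    moreover from calculation obtain V' where "V' \<in> B2" "e \<in> V'" "V' \<subseteq> V"
      using topological_basisE[OF B2(2)] by metis
    ultimately show ?thesis unfolding I_def by blast
  qed
  then have "{(Z, x). \<exists>e\<in>Z. (x, e) \<in> W} = (\<Union>(U, V)\<in>I. (UNIV - void V) \<times> U)"
    unfolding I_def void_def by blast
  also have "\<dots> \<in> sets (configurations \<Otimes>\<^sub>M borel)"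
  proof (intro sets.countable_UN'' \<open>countable I\<close>)
    fix i assume "i \<in> I"
    then obtain U V where i: "i = (U, V)" "open U" "open V"
      using topological_basis_open[OF B1(2)] topological_basis_open[OF B2(2)] by (auto simp: I_def)
    have "UNIV - void V \<in> sets configurations"
      using sets.compl_sets[OF void_in_sets[of V]] i by simp
    then show "(case i of (U, V) \<Rightarrow> (UNIV - void V) \<times> U) \<in> sets (configurations \<Otimes>\<^sub>M borel)"
      using i by simp
  qed
  finally show ?thesis .
qed

section \<open>Mixing of the Poisson process\<close>

text \<open>
  If set functions dominated by a probability measure converge
  to a multiple of it on a \<open>\<pi>\<close>-system, they do so on the generated \<open>\<sigma>\<close>-algebra, because the class of good sets is a Dynkin system. The domination
  supplies the summable majorant that Tannery's theorem needs for disjoint unions.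
\<close>

lemma tendsto_on_generated_sigma_algebra:
  fixes N :: "'z \<Rightarrow> 'a set \<Rightarrow> real"
  assumes M: "prob_space M" and G: "sets M = sigma_sets (space M) G" "G \<subseteq> Pow (space M)" "Int_stable G"
    and le: "\<And>z X. X \<in> sets M \<Longrightarrow> 0 \<le> N z X \<and> N z X \<le> measure M X"
    and compl: "\<And>z X. X \<in> sets M \<Longrightarrow> N z (space M - X) = N z (space M) - N z X"
    and union: "\<And>z X. range X \<subseteq> sets M \<Longrightarrow> disjoint_family X \<Longrightarrow> (\<lambda>i::nat. N z (X i)) sums N z (\<Union>i. X i)"
    and gen: "\<And>X. X \<in> insert (space M) G \<Longrightarrow> ((\<lambda>z. N z X) \<longlongrightarrow> c * measure M X) F"
    and X: "X \<in> sets M"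
  shows "((\<lambda>z. N z X) \<longlongrightarrow> c * measure M X) F"
proof (cases "F = bot")
  case False
  interpret prob_space M by fact
  have "X \<in> sigma_sets (space M) G" using X G by simp
  with G(3,2) show ?thesis
  proof (induction rule: sigma_sets_induct_disjoint)
    case (basic A)
    then show ?case by (intro gen) auto
  next
    case empty
    have "N z {} = 0" for z using le[of "{}" z] by simp
    then show ?case by simp
  next
    case (compl A)
    then have A: "A \<in> sets M" using G by simp
    have "((\<lambda>z. N z (space M) - N z A) \<longlongrightarrow> c * measure M (space M) - c * measure M A) F"
      by (intro tendsto_diff gen compl.IH) auto
    then show ?case
      using A by (simp add: assms(6) prob_compl right_diff_distrib prob_space)
  next
    case (union A)
    then have A: "range A \<subseteq> sets M" using G by auto
    have s: "(\<lambda>i. measure M (A i)) sums measure M (\<Union>i. A i)"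
      using A union by (intro finite_measure_UNION)
    have "((\<lambda>z. \<Sum>i. N z (A i)) \<longlongrightarrow> (\<Sum>i. c * measure M (A i))) F"
    proof (rule tannerys_theorem[THEN conjunct2, THEN conjunct2])
      show "\<forall>\<^sub>F (i, z) in at_top \<times>\<^sub>F F. norm (N z (A i)) \<le> measure M (A i)"
        using le A by (intro always_eventually) auto
    qed (use s union False in \<open>auto simp: sums_iff\<close>)
    moreover have "(\<Sum>i. N z (A i)) = N z (\<Union>i. A i)" for z
      using assms(7)[OF A] union by (simp add: sums_iff)
    moreover have "(\<Sum>i. c * measure M (A i)) = c * measure M (\<Union>i. A i)"
      using s by (simp add: sums_iff suminf_mult)
    ultimately show ?case by simp
  qed
qed simp

text \<open>
  The previous lemma is used twice, first in the set that is moved with the other one fixed in the generator, then in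
  the set that stays.
\<close>

lemma mixing_from_generator:
  fixes T :: "'z \<Rightarrow> 'a \<Rightarrow> 'a"
  assumes M: "prob_space M" and G: "sets M = sigma_sets (space M) G" "G \<subseteq> Pow (space M)" "Int_stable G"
    and T: "\<And>z. T z \<in> measurable M M" "\<And>z. distr M M (T z) = M"
    and gen: "\<And>A B. A \<in> G \<Longrightarrow> B \<in> G \<Longrightarrow>
      ((\<lambda>z. measure M (A \<inter> (T z -` B \<inter> space M))) \<longlongrightarrow> measure M A * measure M B) F"
    and A: "A \<in> sets M" and B: "B \<in> sets M"
  shows "((\<lambda>z. measure M (A \<inter> (T z -` B \<inter> space M))) \<longlongrightarrow> measure M A * measure M B) F"
proof -
  interpret prob_space M by fact
  have TB: "T z -` X \<inter> space M \<in> sets M" if "X \<in> sets M" for z X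
    using measurable_sets[OF T(1) that] .
  have mT: "measure M (T z -` X \<inter> space M) = measure M X" if "X \<in> sets M" for z X
    using measure_distr[OF T(1) that] T(2) by simp
  have G_sets: "X \<in> sets M" if "X \<in> G" for X using that G by auto
  have step1: "((\<lambda>z. measure M (A \<inter> (T z -` X \<inter> space M))) \<longlongrightarrow> measure M A * measure M X) F"
    if A: "A \<in> G" and X: "X \<in> sets M" for A X
  proof (rule tendsto_on_generated_sigma_algebra[OF M G _ _ _ _ X])
    note As = G_sets[OF A]
    have Aspace: "A \<inter> (T z -` space M \<inter> space M) = A" for z
      using sets.sets_into_space[OF As] measurable_space[OF T(1)] by auto
    show "0 \<le> measure M (A \<inter> (T z -` X \<inter> space M)) \<and> measure M (A \<inter> (T z -` X \<inter> space M)) \<le> measure M X"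
      if "X \<in> sets M" for z X
      using finite_measure_mono[OF _ TB[OF that], of "A \<inter> (T z -` X \<inter> space M)" z] mT[OF that] by auto
    show "measure M (A \<inter> (T z -` (space M - X) \<inter> space M))
        = measure M (A \<inter> (T z -` space M \<inter> space M)) - measure M (A \<inter> (T z -` X \<inter> space M))"
      if "X \<in> sets M" for z X
    proof -
      have "A \<inter> (T z -` (space M - X) \<inter> space M) = A - A \<inter> (T z -` X \<inter> space M)"
        using sets.sets_into_space[OF As] measurable_space[OF T(1)] by auto
      then show ?thesis using As TB[OF that] by (simp add: Aspace finite_measure_Diff sets.Int)
    qed
    show "(\<lambda>i. measure M (A \<inter> (T z -` X i \<inter> space M))) sums measure M (A \<inter> (T z -` (\<Union>i. X i) \<inter> space M))"
      if X: "range X \<subseteq> sets M" "disjoint_family X" for z and X :: "nat \<Rightarrow> _"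
    proof -
      have "A \<inter> (T z -` (\<Union>i. X i) \<inter> space M) = (\<Union>i. A \<inter> (T z -` X i \<inter> space M))" by auto
      moreover have "disjoint_family (\<lambda>i. A \<inter> (T z -` X i \<inter> space M))"
        using X(2) unfolding disjoint_family_on_def by blast
      moreover have "range (\<lambda>i. A \<inter> (T z -` X i \<inter> space M)) \<subseteq> sets M"
        using X(1) As TB by auto
      ultimately show ?thesis using finite_measure_UNION by metis
    qed
    show "((\<lambda>z. measure M (A \<inter> (T z -` X \<inter> space M))) \<longlongrightarrow> measure M A * measure M X) F"
      if "X \<in> insert (space M) G" for X
    proof (cases "X = space M")
      case True then show ?thesis by (simp add: Aspace prob_space)
    qed (use gen A that in auto)
  qed
  have "((\<lambda>z. measure M (A \<inter> (T z -` B \<inter> space M))) \<longlongrightarrow> measure M B * measure M A) F"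
  proof (rule tendsto_on_generated_sigma_algebra[OF M G _ _ _ _ A])
    note Bs = TB[OF B]
    show "0 \<le> measure M (X \<inter> (T z -` B \<inter> space M)) \<and> measure M (X \<inter> (T z -` B \<inter> space M)) \<le> measure M X"
      if "X \<in> sets M" for z X
      using finite_measure_mono[OF _ that, of "X \<inter> (T z -` B \<inter> space M)"] by auto
    show "measure M ((space M - X) \<inter> (T z -` B \<inter> space M))
        = measure M (space M \<inter> (T z -` B \<inter> space M)) - measure M (X \<inter> (T z -` B \<inter> space M))"
      if "X \<in> sets M" for z X
    proof -
      have "(space M - X) \<inter> (T z -` B \<inter> space M) = (T z -` B \<inter> space M) - X \<inter> (T z -` B \<inter> space M)"
        by auto
      moreover have "space M \<inter> (T z -` B \<inter> space M) = T z -` B \<inter> space M" by auto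
      moreover have "measure M ((T z -` B \<inter> space M) - X \<inter> (T z -` B \<inter> space M))
          = measure M (T z -` B \<inter> space M) - measure M (X \<inter> (T z -` B \<inter> space M))"
        by (rule finite_measure_Diff) (use that Bs in auto)
      ultimately show ?thesis by simp
    qed
    show "(\<lambda>i. measure M (X i \<inter> (T z -` B \<inter> space M))) sums measure M ((\<Union>i. X i) \<inter> (T z -` B \<inter> space M))"
      if X: "range X \<subseteq> sets M" "disjoint_family X" for z and X :: "nat \<Rightarrow> _"
    proof -
      have "(\<Union>i. X i) \<inter> (T z -` B \<inter> space M) = (\<Union>i. X i \<inter> (T z -` B \<inter> space M))" by auto
      moreover have "disjoint_family (\<lambda>i. X i \<inter> (T z -` B \<inter> space M))"
        using X(2) unfolding disjoint_family_on_def by blast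
      moreover have "range (\<lambda>i. X i \<inter> (T z -` B \<inter> space M)) \<subseteq> sets M"
        using X(1) Bs by auto
      ultimately show ?thesis using finite_measure_UNION by metis
    qed
    show "((\<lambda>z. measure M (X \<inter> (T z -` B \<inter> space M))) \<longlongrightarrow> measure M B * measure M X) F"
      if "X \<in> insert (space M) G" for X
    proof (cases "X = space M")
      case True
      have "space M \<inter> (T z -` B \<inter> space M) = T z -` B \<inter> space M" for z by auto
      then show ?thesis using True by (simp add: mT[OF B] prob_space)
    next
      case False
      then have "X \<in> G" using that by simp
      from step1[OF this B] show ?thesis by (simp add: mult.commute)
    qed
  qed
  then show ?thesis by (simp add: mult.commute)
qed

text \<open>
  As soon as the translation separates two bounded sets, their volumes add, and the void
  probability of the union is exactly the product.
\<close>

lemma poisson_process_mixing: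
  fixes \<tau> :: "'z \<Rightarrow> 'a::euclidean_space"
  assumes \<tau>: "filterlim \<tau> at_infinity F"
    and A: "A \<in> sets configurations" and B: "B \<in> sets configurations"
  shows "((\<lambda>z. measure poisson_process (A \<inter> translate (\<tau> z) -` B)) \<longlongrightarrow>
    measure poisson_process A * measure poisson_process B) F"
proof -
  have "((\<lambda>z. measure poisson_process (A \<inter> (translate (\<tau> z) -` B \<inter> space poisson_process))) \<longlongrightarrow>
    measure poisson_process A * measure poisson_process B) F"
  proof (rule mixing_from_generator[OF prob_space_poisson_process])
    show "sets poisson_process = sigma_sets (space poisson_process) (void ` {A :: 'a set. A \<in> sets borel \<and> bounded A})"
      by (simp add: sets_configurations)
    show "translate (\<tau> z) \<in> measurable poisson_process poisson_process" for z
      unfolding measurable_poisson_process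
      using translate_measurable measurable_cong_sets[OF refl sets_poisson_process] by blast
    show "distr poisson_process poisson_process (translate (\<tau> z)) = poisson_process" for z
      using poisson_process_translate[of "\<tau> z"] distr_cong[OF refl sets_poisson_process] by metis
    fix V W :: "'a set set"
    assume "V \<in> void ` {A. A \<in> sets borel \<and> bounded A}" "W \<in> void ` {A. A \<in> sets borel \<and> bounded A}"
    then obtain A B :: "'a set" where V: "V = void A" "A \<in> sets borel" "bounded A"
      and W: "W = void B" "B \<in> sets borel" "bounded B" by auto
    obtain r where r: "\<And>x. x \<in> A \<Longrightarrow> norm x \<le> r" "\<And>x. x \<in> B \<Longrightarrow> norm x \<le> r"
      using V(3) W(3) unfolding bounded_iff by (meson max.coboundedI1 max.coboundedI2)
    have "\<forall>\<^sub>F z in F. norm (\<tau> z) \<ge> 2 * r + 1"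
      using \<tau> filterlim_norm_at_top by (metis filterlim_at_infinity_imp_norm_at_top filterlim_at_top)
    then have "\<forall>\<^sub>F z in F. measure poisson_process V * measure poisson_process W
        = measure poisson_process (V \<inter> (translate (\<tau> z) -` W \<inter> space poisson_process))"
    proof eventually_elim
      case (elim z)
      let ?B = "(\<lambda>x. x + \<tau> z) ` B"
      have B: "?B \<in> sets borel" by (rule translation_borel[OF W(2)])
      have Bb: "bounded ?B"
        using bounded_translation[OF W(3), of "\<tau> z"] by (simp add: add.commute[of _ "\<tau> z"])
      have "A \<inter> ?B = {}"
      proof (rule ccontr)
        assume "A \<inter> ?B \<noteq> {}"
        then obtain x where "x \<in> B" "x + \<tau> z \<in> A" by auto
        then show False
          using r(1)[of "x + \<tau> z"] r(2)[of x] elim norm_triangle_ineq4[of "x + \<tau> z" x] by simp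
      qed
      then have "measure lborel (A \<union> ?B) = measure lborel A + measure lborel ?B"
        using V W B emeasure_bounded_finite[OF V(3)] emeasure_bounded_finite[OF Bb]
        by (intro measure_Union) auto
      then show ?case
        using V W B Bb
        by (simp add: translate_vimage_void void_Un measure_poisson_void measure_lborel_translation bounded_Un flip: exp_add)
    qed
    then show "((\<lambda>z. measure poisson_process (V \<inter> (translate (\<tau> z) -` W \<inter> space poisson_process))) \<longlongrightarrow>
        measure poisson_process V * measure poisson_process W) F"
      by (rule tendsto_eventually[OF eventually_mono]) simp
  qed (use A B Int_stable_void in auto)
  then show ?thesis by simp
qed

section \<open>The field of barriers\<close>

text \<open>
  The growth must beat every exponential: \<open>scale_length n / scale_length m \<le> 4^(-n-m)\<close> for \<open>n < m\<close>
  absorbs the polynomial factors that arise when larger barriers are counted.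
\<close>

definition scale_length :: "nat \<Rightarrow> real" where
  "scale_length n = 4 ^ (n\<^sup>2)"

definition along :: "nat \<Rightarrow> 2" where
  "along n = (if odd n then 1 else 2)"

definition across :: "nat \<Rightarrow> 2" where
  "across n = (if odd n then 2 else 1)"

text \<open>
  The windows of different scales are disjoint, and the length of the window is the planar intensity of the
  barriers of scale \<open>n\<close>.
\<close>

definition marks :: "nat \<Rightarrow> real set" where
  "marks n = {real n<..<real n + 1 / (scale_length n)\<^sup>2}"

text \<open>
  Half the side of the square around the origin that barriers of larger scales must leave untouched; the
  additional \<open>1\<close> leaves room for the width of a barrier and the support of the mollifier.
\<close>

definition reach :: "nat \<Rightarrow> real" where
  "reach n = real n * scale_length n + 1"

text \<open>
  A centre may be as far as \<open>n * scale_length n\<close> from the origin in the direction of its barrier; this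
  length still lets the barrier cover the range from \<open>- reach n\<close> to \<open>reach n\<close>.
\<close>

definition half_length :: "nat \<Rightarrow> real" where
  "half_length n = 2 * real n * scale_length n + 1"

text \<open>
  One relation between the point \<open>x\<close> of the plane, the centre \<open>p\<close> and the mark \<open>r\<close>, because openness
  in all of them together is what makes barriers jointly measurable in the configuration and \<open>x\<close>.
\<close>

definition barrier_incidence :: "nat \<Rightarrow> ((real^2) \<times> (real^2) \<times> real) set" where
  "barrier_incidence n = {(x, p, r). r \<in> marks n \<and>
     \<bar>x $ along n - p $ along n\<bar> < half_length n \<and> \<bar>x $ across n - p $ across n\<bar> < 1}"

definition barriers :: "nat \<Rightarrow> ((real^2) \<times> real) set \<Rightarrow> (real^2) set" where
  "barriers n Z = {x. \<exists>e\<in>Z. (x, e) \<in> barrier_incidence n}"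

text \<open>
  The largest scale at \<open>x\<close> decides. Points on no barrier, and points on barriers of infinitely
  many scales, count as not horizontal.
\<close>

definition horizontal :: "((real^2) \<times> real) set \<Rightarrow> (real^2) set" where
  "horizontal Z = {x. \<exists>n. odd n \<and> x \<in> barriers n Z \<and> (\<forall>m>n. x \<notin> barriers m Z)}"

definition direction :: "((real^2) \<times> real) set \<Rightarrow> vector_field" where
  "direction Z x = (if x \<in> horizontal Z then axis 1 1 else axis 2 1)"

definition mollifier :: "real^2 \<Rightarrow> real" where
  "mollifier x = bump x / (LINT y|lborel. bump (y::real^2))"

definition barrier_field :: "((real^2) \<times> real) set \<Rightarrow> vector_field" where
  "barrier_field Z = convolve mollifier (direction Z)"

lemma scale_length_ge_1: "scale_length n \<ge> 1"
  unfolding scale_length_def by simp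

lemma along_across: "along n \<noteq> across n" "k = along n \<or> k = across n"
  using exhaust_2[of k] by (auto simp: along_def across_def)

lemma open_barrier_incidence: "open (barrier_incidence n)"
proof -
  have "barrier_incidence n = {w. real n < snd (snd w) \<and> snd (snd w) < real n + 1 / (scale_length n)\<^sup>2 \<and>
     \<bar>fst w $ along n - fst (snd w) $ along n\<bar> < half_length n \<and> \<bar>fst w $ across n - fst (snd w) $ across n\<bar> < 1}"
    by (auto simp: barrier_incidence_def marks_def)
  then show ?thesis
    by (auto intro!: open_Collect_conj open_Collect_less continuous_intros)
qed

lemma barriers_measurable: "{w. snd w \<in> barriers n (fst w)} \<in> sets (configurations \<Otimes>\<^sub>M borel)"
  using exists_point_measurable[OF open_barrier_incidence[of n]] by (simp add: barriers_def case_prod_beta')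

lemma direction_measurable:
  "(\<lambda>w. direction (fst w) (snd w)) \<in> borel_measurable (configurations \<Otimes>\<^sub>M borel)"
proof -
  have [measurable]: "Measurable.pred (configurations \<Otimes>\<^sub>M borel) (\<lambda>w. snd w \<in> barriers n (fst w))" for n
    using barriers_measurable[of n] by (simp add: pred_def space_pair_measure)
  have [measurable]: "Measurable.pred (configurations \<Otimes>\<^sub>M borel) (\<lambda>w. snd w \<in> horizontal (fst w))"
    unfolding horizontal_def mem_Collect_eq by measurable
  show ?thesis unfolding direction_def by measurable
qed

lemma direction_section_measurable: "direction Z \<in> borel_measurable borel"
  using measurable_compose[OF measurable_Pair1' direction_measurable, of Z] by simp

lemma norm_direction: "norm (direction Z x) \<le> 1"
  by (simp add: direction_def)

lemma smooth_mollifier: "smooth mollifier"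
proof -
  have "mollifier = (\<lambda>x. bump x * (1 / (LINT y|lborel. bump (y::real^2))))"
    by (simp add: mollifier_def fun_eq_iff)
  then show ?thesis
    using smooth_bump C_k_mult[OF _ C_k_const] unfolding smooth_def by metis
qed

lemma mollifier_nonneg: "mollifier x \<ge> 0"
  unfolding mollifier_def using bump_integral_pos bump_nonneg by (intro divide_nonneg_pos)

lemma mollifier_eq_0: "norm x \<ge> 1/2 \<Longrightarrow> mollifier x = 0"
  unfolding mollifier_def by (simp add: bump_eq_0)

lemma mollifier_outside: "norm x > 1/2 \<Longrightarrow> mollifier x = 0"
  by (rule mollifier_eq_0) simp

lemma mollifier_continuous: "continuous_on UNIV mollifier"
  using smooth_mollifier unfolding smooth_def by (metis C_k.simps(1))

lemma mollifier_C_1: "C_k 1 mollifier"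
  using smooth_mollifier unfolding smooth_def by blast

lemma mollifier_integral: "(LINT y|lborel. mollifier (x - y)) = 1"
proof -
  have "(LINT y|lborel. mollifier (x - y)) = (LINT y|lborel. mollifier (- x + y))"
    by (simp add: mollifier_def bump_minus[of x])
  also have "\<dots> = (LINT y|lborel. mollifier y)"
    by (rule lborel_integral_translate) (rule borel_measurable_continuous_onI[OF mollifier_continuous])
  finally show ?thesis unfolding mollifier_def using bump_integral_pos[where 'a = "real^2"] by simp
qed

lemma barrier_field_smooth: "smooth (barrier_field Z)"
  unfolding smooth_def barrier_field_def
  using C_k_convolve[OF direction_section_measurable norm_direction smooth_mollifier mollifier_outside] by blast

lemma barrier_field_component:
  "barrier_field Z x $ i = (LINT y|lborel. mollifier (x - y) * direction Z y $ i)"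
proof -
  have int: "integrable lborel (\<lambda>y. mollifier (x - y) *\<^sub>R direction Z y)"
    by (rule convolve_integrable[OF direction_section_measurable norm_direction mollifier_continuous mollifier_outside])
  show ?thesis
    unfolding barrier_field_def convolve_def
    using integral_bounded_linear[OF bounded_linear_vec_nth int, of i] by simp
qed

lemma mollifier_direction_integrable: "integrable lborel (\<lambda>y. mollifier (x - y) * direction Z y $ i)"
proof -
  have int: "integrable lborel (\<lambda>y. mollifier (x - y) *\<^sub>R direction Z y)"
    by (rule convolve_integrable[OF direction_section_measurable norm_direction mollifier_continuous mollifier_outside])
  show ?thesis
    using integrable_bounded_linear[OF bounded_linear_vec_nth int, of i] by simp
qed

lemma barrier_field_nonneg: "barrier_field Z x $ i \<ge> 0"
  unfolding barrier_field_component
  by (intro Bochner_Integration.integral_nonneg mult_nonneg_nonneg mollifier_nonneg) (simp add: direction_def axis_def)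

lemma barrier_field_sum: "barrier_field Z x $ 1 + barrier_field Z x $ 2 = 1"
proof -
  have "barrier_field Z x $ 1 + barrier_field Z x $ 2
      = (LINT y|lborel. mollifier (x - y) * direction Z y $ 1 + mollifier (x - y) * direction Z y $ 2)"
    unfolding barrier_field_component by (simp add: mollifier_direction_integrable)
  also have "\<dots> = (LINT y|lborel. mollifier (x - y))"
    by (intro Bochner_Integration.integral_cong) (auto simp: direction_def axis_def)
  finally show ?thesis by (simp add: mollifier_integral)
qed

text \<open>
  The mollifier has integral \<open>1\<close> and support in the ball of radius \<open>1/2\<close>.
\<close>

lemma barrier_field_eq_direction:
  assumes "\<And>y. norm (x - y) < 1/2 \<Longrightarrow> direction Z y = axis i 1"
  shows "barrier_field Z x = axis i 1"
proof -
  have "mollifier (x - y) *\<^sub>R direction Z y = mollifier (x - y) *\<^sub>R axis i 1" for y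
    using assms[of y] mollifier_eq_0[of "x - y"] by (cases "norm (x - y) < 1/2") auto
  then have "barrier_field Z x = (LINT y|lborel. mollifier (x - y) *\<^sub>R axis i 1)"
    by (simp only: barrier_field_def convolve_def)
  also have "\<dots> = (LINT y|lborel. mollifier (x - y)) *\<^sub>R axis i 1"
    by (rule integral_scaleR_left) (metis mollifier_integral not_integrable_integral_eq zero_neq_one)
  finally show ?thesis by (simp add: mollifier_integral)
qed

lemma barrier_field_Lipschitz:
  obtains L where "L > 0" "\<And>Z x y. norm (barrier_field Z x - barrier_field Z y) \<le> L * norm (x - y)"
proof -
  obtain K where K: "K \<ge> 0" "\<And>x y. \<bar>mollifier x - mollifier y\<bar> \<le> K * norm (x - y)"
    using C_1_compact_support_derivative_bound[OF mollifier_C_1 mollifier_outside] by metis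
  let ?L = "2 * K * 1 * measure lborel (cball (0::real^2) (1/2))"
  have "norm (barrier_field Z x - barrier_field Z y) \<le> (?L + 1) * norm (x - y)" for Z x y
  proof -
    have "norm (barrier_field Z x - barrier_field Z y) \<le> ?L * norm (x - y)"
      unfolding barrier_field_def
      by (rule convolve_Lipschitz[OF direction_section_measurable norm_direction mollifier_C_1 mollifier_outside K])
    also have "\<dots> \<le> (?L + 1) * norm (x - y)" by (intro mult_right_mono) auto
    finally show ?thesis .
  qed
  moreover have "?L + 1 > 0" using K(1) by (intro add_nonneg_pos mult_nonneg_nonneg) auto
  ultimately show ?thesis using that by blast
qed

lemma barrier_field_measurable: "barrier_field \<in> measurable configurations borel_fields"
proof -
  obtain L where "L > 0" and L: "\<And>Z x y. norm (barrier_field Z x - barrier_field Z y) \<le> L * norm (x - y)"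
    using barrier_field_Lipschitz by blast
  note [measurable] = direction_measurable borel_measurable_continuous_onI[OF mollifier_continuous]
  have "(\<lambda>Z. barrier_field Z x) \<in> borel_measurable configurations" for x
    unfolding barrier_field_def convolve_def
  proof (rule lborel.borel_measurable_lebesgue_integral)
    have "(\<lambda>w. mollifier (x - snd w) *\<^sub>R direction (fst w) (snd w)) \<in> borel_measurable (configurations \<Otimes>\<^sub>M borel)"
      by measurable
    moreover have "sets (configurations \<Otimes>\<^sub>M lborel) = sets (configurations \<Otimes>\<^sub>M borel)"
      by (intro sets_pair_measure_cong) auto
    ultimately show "case_prod (\<lambda>Z y. mollifier (x - y) *\<^sub>R direction Z y) \<in> borel_measurable (configurations \<Otimes>\<^sub>M lborel)"
      by (simp add: case_prod_beta' cong: measurable_cong_sets)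
  qed
  then show ?thesis
    by (rule Lipschitz_field_measurable[where L = L]) (use \<open>L > 0\<close> L in auto)
qed

lemma barriers_translate: "x \<in> barriers n (translate (z, 0) Z) \<longleftrightarrow> x + z \<in> barriers n Z"
proof -
  have "(x, e - (z, 0)) \<in> barrier_incidence n \<longleftrightarrow> (x + z, e) \<in> barrier_incidence n" for e
    by (cases e) (simp add: barrier_incidence_def algebra_simps)
  then show ?thesis unfolding barriers_def translate_def by simp
qed

lemma barrier_field_translate: "barrier_field (translate (z, 0) Z) = shift z (barrier_field Z)"
proof
  fix x
  have dir: "direction (translate (z, 0) Z) y = direction Z (y + z)" for y
    unfolding direction_def horizontal_def mem_Collect_eq barriers_translate ..
  note [measurable] = direction_section_measurable borel_measurable_continuous_onI[OF mollifier_continuous]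
  have "barrier_field Z (x + z) = (LINT y|lborel. mollifier (x + z - (z + y)) *\<^sub>R direction Z (z + y))"
    unfolding barrier_field_def convolve_def by (rule lborel_integral_translate[symmetric]) measurable
  also have "\<dots> = barrier_field (translate (z, 0) Z) x"
    unfolding barrier_field_def convolve_def dir by (simp add: add.commute)
  finally show "barrier_field (translate (z, 0) Z) x = shift z (barrier_field Z) x"
    by (simp add: shift_def)
qed

section \<open>Trapping by a barrier of a good scale\<close>

definition barrier_site :: "nat \<Rightarrow> ((real^2) \<times> real) set" where
  "barrier_site n = {p. \<bar>p $ along n\<bar> \<le> real n * scale_length n \<and> scale_length n / 2 \<le> p $ across n \<and> p $ across n \<le> scale_length n} \<times> marks n"

text \<open>
  Where the centre of a barrier of scale \<open>m\<close> has to be for the barrier to meet the square of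
  half-side \<open>reach n\<close> around the origin.
\<close>

definition intruder_site :: "nat \<Rightarrow> nat \<Rightarrow> ((real^2) \<times> real) set" where
  "intruder_site n m = {p. \<bar>p $ along m\<bar> \<le> half_length m + reach n \<and> \<bar>p $ across m\<bar> \<le> 1 + reach n} \<times> marks m"

definition good_scale :: "nat \<Rightarrow> ((real^2) \<times> real) set \<Rightarrow> bool" where
  "good_scale n Z \<longleftrightarrow> Z \<inter> barrier_site n \<noteq> {} \<and> (\<forall>m>n. Z \<inter> intruder_site n m = {})"

text \<open>
  Around the centre line of a barrier found in \<open>barrier_site n\<close>, up to distance \<open>1\<close>, no larger
  scale interferes, and the parity of \<open>n\<close> decides the direction. Mollifying keeps this up to distance \<open>1/2\<close>.
\<close>

lemma good_scale_strip:
  assumes good: "good_scale n Z" and n: "n \<ge> 1"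
  obtains h where "scale_length n / 2 \<le> h" "h \<le> scale_length n"
    "\<And>x. \<bar>x $ along n\<bar> \<le> real n * scale_length n \<Longrightarrow> \<bar>x $ across n - h\<bar> \<le> 1/2 \<Longrightarrow> barrier_field Z x = axis (along n) 1"
proof -
  obtain p r where pr: "(p, r) \<in> Z" "r \<in> marks n" "\<bar>p $ along n\<bar> \<le> real n * scale_length n"
    "scale_length n / 2 \<le> p $ across n" "p $ across n \<le> scale_length n"
    using good by (auto simp: good_scale_def barrier_site_def)
  have sn: "scale_length n \<le> real n * scale_length n" using n scale_length_ge_1[of n] by simp
  have dir: "direction Z y = axis (along n) 1" if y: "\<bar>y $ along n\<bar> < reach n" "\<bar>y $ across n - p $ across n\<bar> < 1" for y
  proof -
    have "\<bar>y $ along n - p $ along n\<bar> < half_length n"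
      using y(1) pr(3) by (auto simp: half_length_def reach_def)
    then have "(y, p, r) \<in> barrier_incidence n"
      using y pr by (simp add: barrier_incidence_def)
    then have yn: "y \<in> barriers n Z" using pr(1) unfolding barriers_def by blast
    have "\<bar>y $ across n\<bar> \<le> reach n"
      using y(2) pr(4,5) sn scale_length_ge_1[of n] unfolding reach_def by linarith
    then have yk: "\<bar>y $ k\<bar> \<le> reach n" for k
      using along_across(2)[of k n] y(1) by auto
    have ym: "y \<notin> barriers m Z" if "m > n" for m
    proof
      assume "y \<in> barriers m Z"
      then obtain p' r' where e: "(p', r') \<in> Z" "(y, p', r') \<in> barrier_incidence m"
        unfolding barriers_def by auto
      then have "(p', r') \<in> intruder_site n m"
        using yk[of "along m"] yk[of "across m"] by (auto simp: barrier_incidence_def intruder_site_def)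
      then show False using good \<open>m > n\<close> e(1) unfolding good_scale_def by blast
    qed
    have "y \<in> horizontal Z \<longleftrightarrow> odd n"
    proof
      assume "y \<in> horizontal Z"
      then obtain k where k: "odd k" "y \<in> barriers k Z" "\<forall>m>k. y \<notin> barriers m Z" unfolding horizontal_def by auto
      then have "k = n" using yn ym by (metis linorder_neqE_nat)
      with k show "odd n" by simp
    qed (use yn ym in \<open>auto simp: horizontal_def\<close>)
    then show ?thesis by (simp add: direction_def along_def)
  qed
  have "barrier_field Z x = axis (along n) 1"
    if x: "\<bar>x $ along n\<bar> \<le> real n * scale_length n" "\<bar>x $ across n - p $ across n\<bar> \<le> 1/2" for x
  proof (rule barrier_field_eq_direction)
    fix y assume "norm (x - y) < 1/2"
    then have "\<bar>x $ k - y $ k\<bar> < 1/2" for k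
      using component_le_norm_cart[of "x - y" k] by simp
    from this[of "along n"] this[of "across n"]
    have "\<bar>y $ along n\<bar> < reach n" "\<bar>y $ across n - p $ across n\<bar> < 1"
      using x unfolding reach_def by linarith+
    then show "direction Z y = axis (along n) 1" by (rule dir)
  qed
  with pr that show ?thesis by blast
qed

lemma integral_curve_carried:
  assumes good: "good_scale n Z" "n \<ge> 1" and z: "\<And>k. \<bar>z $ k\<bar> \<le> scale_length n / 2 - 1/2"
    and \<gamma>: "solves_from (barrier_field Z) z \<gamma>"
  shows "\<exists>t\<ge>0. \<gamma> t $ along n = real n * scale_length n \<and> \<gamma> t $ across n \<le> 2 * scale_length n"
proof -
  have d: "((\<lambda>t. \<gamma> t $ k) has_real_derivative barrier_field Z (\<gamma> t) $ k) (at t within {0..})" if "t \<ge> 0" for t k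
    using bounded_linear.has_vector_derivative[OF bounded_linear_vec_nth, of \<gamma> "barrier_field Z (\<gamma> t)" "at t within {0..}" k]
      \<gamma> that unfolding solves_from_def has_real_derivative_iff_has_vector_derivative by blast
  interpret monotone_unit_curve "\<lambda>t. \<gamma> t $ along n" "\<lambda>t. \<gamma> t $ across n"
    "\<lambda>t. barrier_field Z (\<gamma> t) $ along n" "\<lambda>t. barrier_field Z (\<gamma> t) $ across n"
    by unfold_locales
       (use d barrier_field_nonneg barrier_field_sum in \<open>auto simp: along_def across_def add.commute\<close>)
  obtain h where h: "scale_length n / 2 \<le> h" "h \<le> scale_length n"
    "\<And>x. \<bar>x $ along n\<bar> \<le> real n * scale_length n \<Longrightarrow> \<bar>x $ across n - h\<bar> \<le> 1/2 \<Longrightarrow> barrier_field Z x = axis (along n) 1"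
    using good_scale_strip[OF good] by blast
  have start: "\<gamma> 0 = z" using \<gamma> by (simp add: solves_from_def)
  have sn: "scale_length n \<le> real n * scale_length n" using good(2) scale_length_ge_1[of n] by simp
  have z_along: "\<bar>\<gamma> 0 $ along n\<bar> \<le> real n * scale_length n"
    unfolding start using z[of "along n"] sn scale_length_ge_1[of n] by linarith
  have z_across: "\<gamma> 0 $ across n \<le> h - 1/2"
    unfolding start using z[of "across n"] h(1) by linarith
  have "\<exists>t\<ge>0. \<gamma> t $ along n = real n * scale_length n \<and> \<gamma> t $ across n \<le> h + 1/2"
  proof (rule carried_along_barrier[of "h - 1/2" _ "- (real n * scale_length n)"])
    fix t
    assume "- (real n * scale_length n) \<le> \<gamma> t $ along n" "\<gamma> t $ along n \<le> real n * scale_length n"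
      "h - 1/2 \<le> \<gamma> t $ across n" "\<gamma> t $ across n \<le> h + 1/2"
    then show "barrier_field Z (\<gamma> t) $ across n = 0"
      using along_across(1)[of n] by (subst h(3)) (unfold abs_le_iff, auto simp: axis_def)
  qed (use z_along z_across in \<open>auto simp: abs_le_iff\<close>)
  then show ?thesis using h(2) scale_length_ge_1[of n] by force
qed

section \<open>Almost surely all large scales are good\<close>

text \<open>
  Over the marks of scale \<open>n\<close>, the third dimension contributes the factor \<open>1 / (scale_length n)\<^sup>2\<close>.
\<close>

lemma rectangle_marks:
  fixes i j :: 2 and n :: nat
  assumes ij: "i \<noteq> j" and le: "a \<le> b" "c \<le> d"
  defines "S \<equiv> {p::real^2. a \<le> p $ i \<and> p $ i \<le> b \<and> c \<le> p $ j \<and> p $ j \<le> d} \<times> marks n"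
  shows "S \<in> sets borel" "bounded S" "measure lborel S = (b - a) * (d - c) / (scale_length n)\<^sup>2"
proof -
  define lo hi where "lo = (\<chi> k. if k = i then a else c)" and "hi = (\<chi> k. if k = i then b else d)"
  have cases: "k = i \<or> k = j" for k
    using exhaust_2[of i] exhaust_2[of j] exhaust_2[of k] ij by auto
  then have U: "(UNIV :: 2 set) = {i, j}" by blast
  have all: "(\<forall>k. Q k) \<longleftrightarrow> Q i \<and> Q j" for Q :: "2 \<Rightarrow> bool"
    using cases by metis
  have prod: "(\<Prod>k\<in>UNIV. f k) = f i * f j" for f :: "2 \<Rightarrow> real"
    unfolding U using ij by simp
  have S: "S = cbox lo hi \<times> marks n"
    using ij by (auto simp: S_def mem_box_cart all lo_def hi_def)
  show "bounded S" unfolding S marks_def by (intro bounded_Times) auto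
  have m: "emeasure lborel (marks n) = ennreal (1 / (scale_length n)\<^sup>2)"
    unfolding marks_def by (subst emeasure_lborel_Ioo) auto
  have "cbox lo hi \<noteq> {}" using le ij by (simp add: interval_ne_empty_cart all lo_def hi_def)
  then have "measure lborel (cbox lo hi) = (b - a) * (d - c)"
    using ij by (subst content_cbox_if_cart) (simp add: prod lo_def hi_def)
  then have c: "emeasure lborel (cbox lo hi) = ennreal ((b - a) * (d - c))"
    by (metis emeasure_eq_ennreal_measure emeasure_lborel_cbox_finite less_irrefl infinity_ennreal_def)
  have "emeasure (lborel \<Otimes>\<^sub>M lborel) S = ennreal ((b - a) * (d - c) / (scale_length n)\<^sup>2)"
    unfolding S using le
    by (subst lborel.emeasure_pair_measure_Times) (auto simp: c m marks_def ennreal_mult[symmetric])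
  then have "emeasure lborel S = ennreal ((b - a) * (d - c) / (scale_length n)\<^sup>2)" by (simp add: lborel_prod)
  then show "measure lborel S = (b - a) * (d - c) / (scale_length n)\<^sup>2"
    using le by (intro measure_eq_emeasure_eq_ennreal) auto
  have "S \<in> sets (borel \<Otimes>\<^sub>M borel)" unfolding S marks_def by auto
  then show "S \<in> sets borel" by (subst borel_prod[symmetric])
qed

lemma barrier_site_volume:
  "barrier_site n \<in> sets borel" "bounded (barrier_site n)" "measure lborel (barrier_site n) = real n"
proof -
  have eq: "barrier_site n = {p. - (real n * scale_length n) \<le> p $ along n \<and> p $ along n \<le> real n * scale_length n \<and>
      scale_length n / 2 \<le> p $ across n \<and> p $ across n \<le> scale_length n} \<times> marks n"
    by (auto simp: barrier_site_def abs_le_iff)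
  have s: "0 \<le> scale_length n" "scale_length n \<noteq> 0" using scale_length_ge_1[of n] by auto
  have ord: "- (real n * scale_length n) \<le> real n * scale_length n" "scale_length n / 2 \<le> scale_length n"
    using s by (auto simp: mult_le_0_iff intro: order.trans[of _ 0])
  note * = rectangle_marks[OF along_across(1)[of n] ord, of n]
  show "barrier_site n \<in> sets borel" "bounded (barrier_site n)" unfolding eq by (rule *)+
  show "measure lborel (barrier_site n) = real n"
    unfolding eq *(3) using s by (simp add: field_simps power2_eq_square)
qed

text \<open>
  For \<open>n < m\<close> one has \<open>m\<^sup>2 \<ge> n\<^sup>2 + n + m\<close>.
\<close>

lemma scale_length_ratio:
  assumes "n < m"
  shows "scale_length n / scale_length m \<le> (1/4) ^ n * (1/4) ^ m"
proof -
  have "n + m + n\<^sup>2 \<le> m\<^sup>2"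
  proof -
    have "m * (n + 1) \<le> m * m" "(n + 1) * n \<le> m * n" using assms by (intro mult_le_mono; simp)+
    then show ?thesis by (simp add: power2_eq_square)
  qed
  then have "(4::real) ^ (n + m + n\<^sup>2) \<le> 4 ^ (m\<^sup>2)" by (intro power_increasing) auto
  then show ?thesis by (simp add: scale_length_def power_add field_simps)
qed

lemma intruder_site_volume:
  assumes "1 \<le> n" "n < m"
  shows "intruder_site n m \<in> sets borel" "bounded (intruder_site n m)"
    "measure lborel (intruder_site n m) \<le> 60 * ((1/2) ^ n * (1/2) ^ m)"
proof -
  let ?a = "half_length m + reach n" and ?c = "1 + reach n"
  have eq: "intruder_site n m = {p. - ?a \<le> p $ along m \<and> p $ along m \<le> ?a \<and> - ?c \<le> p $ across m \<and> p $ across m \<le> ?c} \<times> marks m"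
    by (auto simp: intruder_site_def abs_le_iff)
  have s: "1 \<le> scale_length n" "1 \<le> scale_length m" "1 \<le> real n" "1 \<le> real m"
    using scale_length_ge_1 assms by auto
  have p: "1 \<le> real n * scale_length n" "1 \<le> real m * scale_length m"
    using mult_mono[of 1 "real n" 1 "scale_length n"] mult_mono[of 1 "real m" 1 "scale_length m"] s by auto
  have a0: "0 \<le> ?a" "0 \<le> ?c" using p by (auto simp: half_length_def reach_def)
  note * = rectangle_marks[OF along_across(1)[of m], of "- ?a" ?a "- ?c" ?c m]
  have ord: "- ?a \<le> ?a" "- ?c \<le> ?c" using a0 by auto
  show "intruder_site n m \<in> sets borel" "bounded (intruder_site n m)" unfolding eq by (rule *[OF ord])+
  have "scale_length n \<le> scale_length m"
    unfolding scale_length_def using assms by (intro power_increasing power_mono) auto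
  then have "real n * scale_length n \<le> real m * scale_length m"
    using assms s by (intro mult_mono) auto
  then have a: "?a \<le> 5 * (real m * scale_length m)"
    using p unfolding half_length_def reach_def by simp
  have c: "?c \<le> 3 * (real n * scale_length n)" using p unfolding reach_def by simp
  have "measure lborel (intruder_site n m) = (?a - - ?a) * (?c - - ?c) / (scale_length m)\<^sup>2"
    unfolding eq by (rule *(3)[OF ord])
  also have "\<dots> = 4 * (?a * ?c) / (scale_length m)\<^sup>2" by (simp add: algebra_simps)
  also have "\<dots> \<le> 4 * ((5 * (real m * scale_length m)) * (3 * (real n * scale_length n))) / (scale_length m)\<^sup>2"
    using a c a0 p by (intro divide_right_mono mult_left_mono mult_mono) auto
  also have "\<dots> = 60 * (real m * real n) * (scale_length n / scale_length m)"
    using s by (simp add: power2_eq_square field_simps)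
  also have "\<dots> \<le> 60 * (2 ^ m * 2 ^ n) * ((1/4) ^ n * (1/4) ^ m)"
    using s by (intro mult_mono scale_length_ratio assms) (auto simp: less_imp_le of_nat_less_two_power)
  also have "\<dots> = 60 * ((1/2) ^ n * (1/2) ^ m)"
    by (simp add: power_divide power_mult_distrib[symmetric] field_simps)
  finally show "measure lborel (intruder_site n m) \<le> 60 * ((1/2) ^ n * (1/2) ^ m)" .
qed

text \<open>
  The site of scale \<open>n\<close> has volume \<open>n\<close>, so it is empty with probability \<open>exp (- n)\<close>; the volumes of
  the sites of intruders are summable in the larger scale.
\<close>

lemma bad_scale_rare:
  assumes "n \<ge> 1"
  shows "{Z. \<not> good_scale n Z} \<in> sets configurations"
    "measure poisson_process {Z. \<not> good_scale n Z} \<le> exp (- real n) + 120 * (1/2) ^ n"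
proof -
  interpret prob_space "poisson_process :: ((real^2) \<times> real) set measure" by (rule prob_space_poisson_process)
  define D where "D m = (if n < m then - void (intruder_site n m) else {})" for m
  have eq: "{Z. \<not> good_scale n Z} = void (barrier_site n) \<union> (\<Union>m. D m)"
    by (auto simp: good_scale_def void_def D_def split: if_splits)
  have V: "void (barrier_site n) \<in> events" using void_in_sets[OF barrier_site_volume(1)] by simp
  have D: "D m \<in> events" for m
    using void_in_sets[OF intruder_site_volume(1)[OF assms], of m] sets.compl_sets[of "void (intruder_site n m)" configurations]
    by (simp add: D_def Compl_eq_Diff_UNIV)
  show "{Z. \<not> good_scale n Z} \<in> sets configurations"
    unfolding eq using V D by auto
  have Dm: "prob (D m) \<le> 60 * ((1/2) ^ n * (1/2) ^ m)" for m
    using poisson_hit[OF intruder_site_volume(1,2)[OF assms, of m]] intruder_site_volume(3)[OF assms, of m]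
    by (auto simp: D_def)
  have g: "summable (\<lambda>m. 60 * ((1/2) ^ n * (1/2::real) ^ m))" by (intro summable_mult summable_geometric) simp
  have sD: "summable (\<lambda>m. prob (D m))"
    by (rule summable_comparison_test[OF _ g]) (use Dm in auto)
  have "prob (\<Union>m. D m) \<le> (\<Sum>m. prob (D m))"
    using D sD by (intro finite_measure_subadditive_countably) auto
  also have "\<dots> \<le> (\<Sum>m. 60 * ((1/2) ^ n * (1/2::real) ^ m))" by (intro suminf_le Dm sD g)
  also have "\<dots> = 120 * (1/2) ^ n"
    by (simp add: suminf_mult suminf_geometric)
  finally have "prob (\<Union>m. D m) \<le> 120 * (1/2) ^ n" .
  moreover have "prob (void (barrier_site n)) = exp (- real n)"
    using measure_poisson_void[OF barrier_site_volume(1,2)[of n]] barrier_site_volume(3)[of n] by simp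
  moreover have "prob {Z. \<not> good_scale n Z} \<le> prob (void (barrier_site n)) + prob (\<Union>m. D m)"
    unfolding eq using V D by (intro measure_Un_le) auto
  ultimately show "prob {Z. \<not> good_scale n Z} \<le> exp (- real n) + 120 * (1/2) ^ n" by simp
qed

lemma AE_good_scales: "AE Z in poisson_process. \<forall>\<^sub>F n in sequentially. good_scale n Z"
proof -
  interpret prob_space "poisson_process :: ((real^2) \<times> real) set measure" by (rule prob_space_poisson_process)
  have s: "summable (\<lambda>n. exp (- real (Suc n)) + 120 * (1/2) ^ Suc n)"
  proof (intro summable_add summable_mult)
    have "(\<lambda>n. exp (- real (Suc n))) = (\<lambda>n. exp (- 1) * exp (- 1) ^ n)"
      by (simp add: fun_eq_iff exp_of_nat_mult[symmetric] exp_add[symmetric] algebra_simps)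
    then show "summable (\<lambda>n. exp (- real (Suc n)))" by (simp add: summable_mult summable_geometric)
    show "summable (\<lambda>n. (1/2::real) ^ Suc n)" using power_half_series sums_summable by blast
  qed
  have "AE Z in poisson_process. \<forall>\<^sub>F n in sequentially. Z \<in> space poisson_process - {Z. \<not> good_scale (Suc n) Z}"
  proof (rule borel_cantelli_AE1)
    show "summable (\<lambda>n. prob {Z. \<not> good_scale (Suc n) Z})"
      by (rule summable_comparison_test[OF _ s]) (use bad_scale_rare(2)[of "Suc _"] in auto)
  qed (use bad_scale_rare(1)[of "Suc _"] in \<open>auto simp: emeasure_eq_measure\<close>)
  then show ?thesis
    by eventually_elim (simp add: eventually_sequentially_Suc[of "\<lambda>n. good_scale n _"])
qed

section \<open>Stationarity, mixing and oscillation\<close>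

text \<open>
  Every sufficiently large scale carries the curve along one of its barriers; odd scales make the ratio
  small, even scales make it large.
\<close>

lemma integral_curve_oscillates:
  assumes good: "\<forall>\<^sub>F n in sequentially. good_scale n Z" and \<gamma>: "solves_from (barrier_field Z) z \<gamma>"
  shows "filterlim (\<lambda>t. norm (\<gamma> t)) at_top at_top"
    "Liminf at_top (\<lambda>t. ereal (\<gamma> t $ 2 / \<gamma> t $ 1)) = 0"
    "Limsup at_top (\<lambda>t. ereal (\<gamma> t $ 2 / \<gamma> t $ 1)) = \<infinity>"
proof -
  have d: "((\<lambda>t. \<gamma> t $ k) has_real_derivative barrier_field Z (\<gamma> t) $ k) (at t within {0..})" if "t \<ge> 0" for t k
    using bounded_linear.has_vector_derivative[OF bounded_linear_vec_nth, of \<gamma> "barrier_field Z (\<gamma> t)" "at t within {0..}" k]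
      \<gamma> that unfolding solves_from_def has_real_derivative_iff_has_vector_derivative by blast
  interpret monotone_unit_curve "\<lambda>t. \<gamma> t $ 1" "\<lambda>t. \<gamma> t $ 2"
    "\<lambda>t. barrier_field Z (\<gamma> t) $ 1" "\<lambda>t. barrier_field Z (\<gamma> t) $ 2"
    by unfold_locales (use d barrier_field_nonneg barrier_field_sum in auto)
  obtain N where N: "\<And>n. n \<ge> N \<Longrightarrow> good_scale n Z"
    using good by (auto simp: eventually_sequentially)
  have carried: "\<exists>n t. (odd n \<longleftrightarrow> b) \<and> t \<ge> 0 \<and> \<gamma> t $ along n \<ge> K \<and> \<gamma> t $ across n \<le> \<gamma> t $ along n / K"
    if K: "K > 0" for K :: real and b
  proof -
    \<comment> \<open>\<open>2 norm z + 1\<close> puts the starting point below the barrier, and \<open>2 K\<close> makes the ratio at the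
      far end, at most \<open>2 / n\<close>, no larger than \<open>1 / K\<close>.\<close>
    obtain n0 where n0: "max (max (real N) (2 * norm z + 1)) (max (2 * K) 1) \<le> real n0" using real_arch_simple by blast
    define n where "n = (if odd n0 \<longleftrightarrow> b then n0 else Suc n0)"
    have n: "odd n \<longleftrightarrow> b" "n0 \<le> n" by (auto simp: n_def)
    then have n': "N \<le> n" "2 * norm z + 1 \<le> real n" "2 * K \<le> real n" "1 \<le> real n" using n0 by auto
    have "n \<le> n\<^sup>2" by (simp add: power2_eq_square)
    also have "n\<^sup>2 < 4 ^ (n\<^sup>2)" by (rule less_exp[THEN order.strict_trans2]) (auto intro: power_mono)
    finally have "real n < 4 ^ (n\<^sup>2)" by (metis of_nat_less_iff of_nat_numeral of_nat_power)
    then have sc: "real n \<le> scale_length n" by (simp add: scale_length_def)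
    have "\<bar>z $ k\<bar> \<le> scale_length n / 2 - 1/2" for k
      using component_le_norm_cart[of z k] n'(2) sc by simp
    then obtain t where t: "t \<ge> 0" "\<gamma> t $ along n = real n * scale_length n" "\<gamma> t $ across n \<le> 2 * scale_length n"
      using integral_curve_carried[OF N[OF n'(1)] _ _ \<gamma>] n'(4) by force
    have "K \<le> real n" using n'(3) K by simp
    also have "\<dots> \<le> real n * scale_length n"
      using mult_left_mono[OF scale_length_ge_1[of n], of "real n"] by simp
    finally have 1: "K \<le> \<gamma> t $ along n" by (simp add: t)
    have "2 * scale_length n * K \<le> real n * scale_length n"
      using mult_right_mono[OF n'(3), of "scale_length n"] scale_length_ge_1[of n] by (simp add: mult_ac)
    then have "2 * scale_length n \<le> \<gamma> t $ along n / K" using K by (simp add: t field_simps)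
    then have "\<gamma> t $ across n \<le> \<gamma> t $ along n / K" using t(3) by linarith
    with 1 t(1) n(1) show ?thesis by blast
  qed
  have low: "\<exists>t\<ge>0. \<gamma> t $ 1 \<ge> K \<and> \<gamma> t $ 2 \<le> \<gamma> t $ 1 / K" if "K > 0" for K
    using carried[OF that, of True] by (auto simp: along_def across_def)
  have high: "\<exists>t\<ge>0. \<gamma> t $ 2 \<ge> K \<and> \<gamma> t $ 1 \<le> \<gamma> t $ 2 / K" if "K > 0" for K
    using carried[OF that, of False] by (auto simp: along_def across_def)
  show "Liminf at_top (\<lambda>t. ereal (\<gamma> t $ 2 / \<gamma> t $ 1)) = 0"
    by (rule ratio_oscillates(1)[OF low high])
  show "Limsup at_top (\<lambda>t. ereal (\<gamma> t $ 2 / \<gamma> t $ 1)) = \<infinity>"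
    by (rule ratio_oscillates(2)[OF low high])
  have "filterlim (\<lambda>t. \<gamma> t $ 1) at_top at_top"
    by (rule filterlim_a) (use low[of "max _ 1"] in \<open>force simp: less_max_iff_disj\<close>)
  then show "filterlim (\<lambda>t. norm (\<gamma> t)) at_top at_top"
    by (rule filterlim_at_top_mono) (auto intro!: always_eventually order.trans[OF abs_ge_self component_le_norm_cart])
qed

lemma barrier_field_integral_curve:
  obtains \<gamma> where "integral_curve (barrier_field Z) z \<gamma>"
proof -
  obtain L where L: "L > 0" "\<And>Z x y. norm (barrier_field Z x - barrier_field Z y) \<le> L * norm (x - y)"
    using barrier_field_Lipschitz by blast
  have "norm (barrier_field Z x) \<le> 1" for x
  proof -
    have "norm (barrier_field Z x) \<le> (\<Sum>i\<in>UNIV. \<bar>barrier_field Z x $ i\<bar>)" by (rule norm_le_l1_cart)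
    also have "\<dots> = 1" using barrier_field_nonneg[of Z x] barrier_field_sum[of Z x] by (simp add: sum_2)
    finally show ?thesis .
  qed
  from Lipschitz_field_integral_curve[OF L(1) L(2)[of Z] this] that show ?thesis by blast
qed

lemma barrier_field_measurable_poisson: "barrier_field \<in> measurable poisson_process borel_fields"
  using barrier_field_measurable by (simp add: measurable_poisson_process)

text \<open>
  Translating the configuration in the plane, with marks unchanged, shifts the field.
\<close>

lemma barrier_field_stationary: "stationary (distr poisson_process borel_fields barrier_field)"
  unfolding stationary_def
proof
  fix z
  have t: "translate (z, 0) \<in> measurable poisson_process (configurations :: ((real^2) \<times> real) set measure)"
    by (simp add: measurable_poisson_process translate_measurable)
  have "distr (distr poisson_process borel_fields barrier_field) borel_fields (shift z)
      = distr poisson_process borel_fields (\<lambda>Z. barrier_field (translate (z, 0) Z))"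
    by (subst distr_distr[OF shift_measurable barrier_field_measurable_poisson]) (simp add: o_def barrier_field_translate)
  also have "\<dots> = distr (distr poisson_process configurations (translate (z, 0))) borel_fields barrier_field"
    by (subst distr_distr[OF barrier_field_measurable t]) (simp add: o_def)
  also have "\<dots> = distr poisson_process borel_fields barrier_field" by (simp add: poisson_process_translate)
  finally show "distr (distr poisson_process borel_fields barrier_field) borel_fields (shift z)
      = distr poisson_process borel_fields barrier_field" .
qed

lemma shift_image_iff: "u \<in> shift z ` B \<longleftrightarrow> shift (- z) u \<in> B"
proof
  assume "shift (- z) u \<in> B"
  moreover have "u = shift z (shift (- z) u)" by (simp add: shift_def)
  ultimately show "u \<in> shift z ` B" by blast
qed (auto simp: shift_def)

lemma barrier_field_mixing: "strongly_mixing (distr poisson_process borel_fields barrier_field)"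
  unfolding strongly_mixing_def
proof (intro ballI)
  fix A B assume A: "A \<in> sets borel_fields" and B: "B \<in> sets borel_fields"
  let ?P = "distr poisson_process borel_fields barrier_field"
  let ?F = "filtercomap (\<lambda>z::real^2. \<bar>z$1\<bar> + \<bar>z$2\<bar>) at_top"
  let ?A = "barrier_field -` A" and ?B = "barrier_field -` B"
  have sets: "?A \<in> sets configurations" "?B \<in> sets configurations"
    using measurable_sets[OF barrier_field_measurable A] measurable_sets[OF barrier_field_measurable B] by auto
  have P: "measure ?P X = measure poisson_process (barrier_field -` X)" if "X \<in> sets borel_fields" for X
    using measure_distr[OF barrier_field_measurable_poisson that] by simp
  have shifted: "measure ?P (A \<inter> shift z ` B) = measure poisson_process (?A \<inter> translate (- z, 0) -` ?B)" for z
  proof -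
    have "A \<inter> shift z ` B = A \<inter> (shift (- z) -` B \<inter> space borel_fields)"
      using sets.sets_into_space[OF A] unfolding set_eq_iff Int_iff vimage_eq shift_image_iff by blast
    then have "A \<inter> shift z ` B \<in> sets borel_fields"
      using measurable_sets[OF shift_measurable B] A by auto
    moreover have "barrier_field -` (A \<inter> shift z ` B) = ?A \<inter> translate (- z, 0) -` ?B"
      unfolding set_eq_iff Int_iff vimage_eq shift_image_iff barrier_field_translate by blast
    ultimately show ?thesis using P by simp
  qed
  \<comment> \<open>The image of \<open>B\<close> under the shift by \<open>z\<close> is the preimage of \<open>B\<close> under the shift by \<open>-z\<close>, hence the sign.\<close>
  have "filterlim (\<lambda>z. norm (- z, 0::real)) at_top ?F"
  proof (rule filterlim_at_top_mono)
    show "filterlim (\<lambda>z. (\<bar>z$1\<bar> + \<bar>z$2\<bar>) * (1/2)) at_top ?F"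
      by (intro filterlim_at_top_mult_tendsto_pos[OF tendsto_const] filterlim_filtercomap) auto
    have "(\<bar>z$1\<bar> + \<bar>z$2\<bar>) * (1/2) \<le> norm (- z, 0::real)" for z :: "real^2"
      using component_le_norm_cart[of z 1] component_le_norm_cart[of z 2] by (simp add: norm_Pair)
    then show "\<forall>\<^sub>F z in ?F. (\<bar>z$1\<bar> + \<bar>z$2\<bar>) * (1/2) \<le> norm (- z, 0::real)" by simp
  qed
  then have "filterlim (\<lambda>z. (- z, 0::real)) at_infinity ?F"
    by (rule filterlim_norm_at_top_imp_at_infinity)
  from poisson_process_mixing[OF this sets]
  have "((\<lambda>z. measure ?P (A \<inter> shift z ` B)) \<longlongrightarrow> measure ?P A * measure ?P B) ?F"
    by (simp add: shifted P A B)
  then show "((\<lambda>z. \<bar>measure ?P (A \<inter> shift z ` B) - measure ?P A * measure ?P B\<bar>) \<longlongrightarrow> 0) ?F"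
    by (intro tendsto_rabs_zero) (simp add: LIM_zero)
qed

text \<open>
  The sample space in the theorem consists of vector fields, so configurations have to be coded
  as such; the code is an indicator function, via a bijection between the reals and their square.
\<close>

lemma ex_injection_configurations:
  obtains \<iota> :: "((real^2) \<times> real) set \<Rightarrow> vector_field" where "inj \<iota>"
proof -
  have "(card_of (UNIV \<times> UNIV :: (real \<times> real) set), card_of (UNIV :: real set)) \<in> ordIso"
    by (rule card_of_Times_same_infinite) (rule infinite_UNIV_char_0)
  then obtain g :: "real \<times> real \<Rightarrow> real" where g: "inj g"
    by (auto simp: card_of_ordIso[symmetric] bij_betw_def)
  define j :: "(real^2) \<times> real \<Rightarrow> real^2" where "j = (\<lambda>(x, r). vec (g (g (x $ 1, x $ 2), r)))"
  have "inj j"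
  proof (rule injI)
    fix e e' assume eq: "j e = j e'"
    obtain x r x' r' where e: "e = (x, r)" "e' = (x', r')" by (cases e, cases e')
    have "g (g (x $ 1, x $ 2), r) = g (g (x' $ 1, x' $ 2), r')"
      using eq unfolding j_def e vec_eq_iff by simp
    then have "g (x $ 1, x $ 2) = g (x' $ 1, x' $ 2)" "r = r'" using injD[OF g] by blast+
    moreover from this(1) have "x $ 1 = x' $ 1" "x $ 2 = x' $ 2" using injD[OF g] by blast+
    ultimately show "e = e'" by (simp add: e vec_eq_iff forall_2)
  qed
  define \<iota> :: "((real^2) \<times> real) set \<Rightarrow> vector_field" where "\<iota> Z = (\<lambda>x. if x \<in> j ` Z then vec 1 else 0)" for Z
  have "inj \<iota>"
  proof (rule injI)
    fix Z Z' assume eq: "\<iota> Z = \<iota> Z'"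
    have "x \<in> j ` Z \<longleftrightarrow> \<iota> Z x $ 1 = 1" for x Z by (simp add: \<iota>_def)
    then have "x \<in> j ` Z \<longleftrightarrow> x \<in> j ` Z'" for x using eq by metis
    then have "j ` Z = j ` Z'" by blast
    then show "Z = Z'" using \<open>inj j\<close> by (simp add: inj_image_eq_iff)
  qed
  with that show ?thesis by blast
qed

theorem theorem1p1:
  shows "\<exists>(\<Omega> :: vector_field measure) (v :: vector_field \<Rightarrow> vector_field).
    prob_space \<Omega> \<and>
    v \<in> measurable \<Omega> borel_fields \<and>
    (\<forall>\<omega>\<in>space \<Omega>. smooth (v \<omega>)) \<and>
    stationary (distr \<Omega> borel_fields v) \<and>
    strongly_mixing (distr \<Omega> borel_fields v) \<and>
    (AE \<omega> in \<Omega>. \<forall>z.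
       v \<omega> z $ 1 \<ge> 0 \<and> v \<omega> z $ 2 \<ge> 0 \<and> v \<omega> z $ 1 + v \<omega> z $ 2 = 1 \<and>
       (\<exists>\<gamma>. integral_curve (v \<omega>) z \<gamma> \<and>
            filterlim (\<lambda>t. norm (\<gamma> t)) at_top at_top \<and>
            Liminf at_top (\<lambda>t. ereal (\<gamma> t $ 2 / \<gamma> t $ 1)) = 0 \<and>
            Limsup at_top (\<lambda>t. ereal (\<gamma> t $ 2 / \<gamma> t $ 1)) = \<infinity>))"
proof -
  obtain \<iota> :: "((real^2) \<times> real) set \<Rightarrow> vector_field" where \<iota>: "inj \<iota>"
    using ex_injection_configurations .
  have \<iota>': "inj_on \<iota> (space poisson_process)" using \<iota> by simp
  define \<Omega> where "\<Omega> = embed_measure poisson_process \<iota>"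
  define v where "v \<omega> = barrier_field (the_inv \<iota> \<omega>)" for \<omega>
  have v\<iota>: "v (\<iota> Z) = barrier_field Z" for Z by (simp add: v_def the_inv_f_f \<iota>)
  have \<iota>_meas: "\<iota> \<in> measurable poisson_process \<Omega>"
    unfolding \<Omega>_def by (rule measurable_embed_measure2[OF \<iota>])
  have v: "v \<in> measurable \<Omega> borel_fields"
    unfolding \<Omega>_def
    by (rule measurable_embed_measure1) (simp add: v\<iota> barrier_field_measurable_poisson)
  have \<Omega>: "\<Omega> = distr poisson_process \<Omega> \<iota>"
    unfolding \<Omega>_def by (rule embed_measure_eq_distr[OF \<iota>])
  have "prob_space \<Omega>"
    by (subst \<Omega>) (intro prob_space.prob_space_distr prob_space_poisson_process \<iota>_meas)
  moreover have law: "distr \<Omega> borel_fields v = distr poisson_process borel_fields barrier_field"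
    by (subst \<Omega>, subst distr_distr[OF v \<iota>_meas]) (simp add: o_def v\<iota>)
  moreover have "AE Z in poisson_process. \<forall>z.
       barrier_field Z z $ 1 \<ge> 0 \<and> barrier_field Z z $ 2 \<ge> 0 \<and> barrier_field Z z $ 1 + barrier_field Z z $ 2 = 1 \<and>
       (\<exists>\<gamma>. integral_curve (barrier_field Z) z \<gamma> \<and>
            filterlim (\<lambda>t. norm (\<gamma> t)) at_top at_top \<and>
            Liminf at_top (\<lambda>t. ereal (\<gamma> t $ 2 / \<gamma> t $ 1)) = 0 \<and>
            Limsup at_top (\<lambda>t. ereal (\<gamma> t $ 2 / \<gamma> t $ 1)) = \<infinity>)"
    using AE_good_scales
  proof eventually_elim
    case (elim Z)
    show ?case
    proof (intro allI conjI)
      fix z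
      obtain \<gamma> where \<gamma>: "integral_curve (barrier_field Z) z \<gamma>" using barrier_field_integral_curve .
      then have "solves_from (barrier_field Z) z \<gamma>" by (simp add: integral_curve_def)
      from integral_curve_oscillates[OF elim this] \<gamma>
      show "\<exists>\<gamma>. integral_curve (barrier_field Z) z \<gamma> \<and> filterlim (\<lambda>t. norm (\<gamma> t)) at_top at_top \<and>
            Liminf at_top (\<lambda>t. ereal (\<gamma> t $ 2 / \<gamma> t $ 1)) = 0 \<and>
            Limsup at_top (\<lambda>t. ereal (\<gamma> t $ 2 / \<gamma> t $ 1)) = \<infinity>" by blast
    qed (rule barrier_field_nonneg barrier_field_sum)+
  qed
  then have "AE \<omega> in \<Omega>. \<forall>z.
       v \<omega> z $ 1 \<ge> 0 \<and> v \<omega> z $ 2 \<ge> 0 \<and> v \<omega> z $ 1 + v \<omega> z $ 2 = 1 \<and>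
       (\<exists>\<gamma>. integral_curve (v \<omega>) z \<gamma> \<and>
            filterlim (\<lambda>t. norm (\<gamma> t)) at_top at_top \<and>
            Liminf at_top (\<lambda>t. ereal (\<gamma> t $ 2 / \<gamma> t $ 1)) = 0 \<and>
            Limsup at_top (\<lambda>t. ereal (\<gamma> t $ 2 / \<gamma> t $ 1)) = \<infinity>)"
    unfolding \<Omega>_def AE_embed_measure[OF \<iota>] v\<iota> .
  ultimately show ?thesis
    using v barrier_field_smooth barrier_field_stationary barrier_field_mixing
    by (intro exI[of _ \<Omega>] exI[of _ v]) (auto simp: v_def)
qed

end
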